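(* Let $q_1=3$ and $q_{n+1}=2^{q_n-1}$ for $n\ge1$. Let $H=\prod_{n\in\mathbb{N}}\{0,\ldots,q_n-1\}$ be the odometer (adding machine) associated to $(q_n)_{n\in\mathbb{N}}$, with the product topology and carry-over addition, and let $\tau:\mathbb{Z}\to H$ be the group homomorphism with $\tau(1)=(1,0,0,\ldots)$. Then there exists a window $W\in\mathcal{W}_{\mathrm{reg}}(H)$ such that $\overline{\mathrm{ac}}(\overline{O_{\mathbb{Z}}(x_W)},\mathbb{Z})=\infty$ (with respect to every Følner sequence in $\mathbb{Z}$) and $\overline{\mathrm{Dim}}_{\mathrm{Box}}(\partial W)=0$ for any metric on $H$.
   Context: Carry-over addition: coordinates are added from left to right, the $n$-th coordinate modulo $q_n$, with carry to coordinate $n+1$; this makes $H$ a compact metrizable abelian group in which $\tau(\mathbb{Z})$ is dense. Let $\nu$ be the normalized Haar measure on $H$. $\mathcal{W}_{\mathrm{reg}}(H)$ is the set of Borel sets $W\subseteq H$ (windows) that are generic ($\partial W\cap\tau(\mathbb{Z})=\emptyset$), proper ($W$ is compact and $W=\overline{\mathrm{int}(W)}$), irredundant ($W+\xi=W$ implies $\xi=0_H$) and regular ($\nu(\partial W)=0$). For a window $W$, $x_W=\mathbf{1}_W\circ\tau\in\{0,1\}^{\mathbb{Z}}$, and $\overline{O_{\mathbb{Z}}(x_W)}$ is its orbit closure under the shift in $\{0,1\}^{\mathbb{Z}}$ with the product topology. For a metric space $(Z,d)$, the upper box dimension is $\overline{\mathrm{Dim}}_{\mathrm{Box}}(Z,d)=\limsup_{\varepsilon\to0}\log\mathrm{Sep}(Z,d,\varepsilon)/(-\log\varepsilon)$,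 where $\mathrm{Sep}(Z,d,\varepsilon)$ is the (possibly infinite) maximal cardinality of a subset whose distinct points have distance $\ge\varepsilon$. A Følner sequence in $\mathbb{Z}$ is a sequence $\mathcal{F}=(F_n)$ of nonempty finite subsets with $\#((g+F_n)\triangle F_n)/\#F_n\to0$ for every $g\in\mathbb{Z}$. Put $D_{\mathcal{F}}(x,y)=\limsup_{n\to\infty}\frac{1}{\#F_n}\#\{g\in F_n:x(g)\ne y(g)\}$. The upper amorphic complexity of a subshift $X\subseteq\{0,1\}^{\mathbb{Z}}$ with respect to $\mathcal{F}$ is the upper box dimension of the metric space $([X]_{\mathcal{F}},D_{\mathcal{F}})$, where $[X]_{\mathcal{F}}$ is the image of $X$ in the quotient of $\{0,1\}^{\mathbb{Z}}$ by the relation $D_{\mathcal{F}}(x,y)=0$; for $X=\overline{O_{\mathbb{Z}}(x_W)}$ with $W\in\mathcal{W}_{\mathrm{reg}}(H)$ it does not depend on $\mathcal{F}$ and is denoted $\overline{\mathrm{ac}}(X,\mathbb{Z})$. *)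

theory Defs
  imports "HOL-Analysis.Analysis" "HOL-Algebra.Coset"
begin

section \<open>Odometers\<close>

text \<open>
  Coordinates are numbered from \<open>0\<close>. The value \<open>odo_carry q x y n\<close> is the carry that
  arrives at coordinate \<open>n\<close> when \<open>x\<close> and \<open>y\<close> are added from left to right.
\<close>

fun odo_carry :: "(nat \<Rightarrow> nat) \<Rightarrow> (nat \<Rightarrow> nat) \<Rightarrow> (nat \<Rightarrow> nat) \<Rightarrow> nat \<Rightarrow> nat" where
  "odo_carry q x y 0 = 0"
| "odo_carry q x y (Suc n) = (x n + y n + odo_carry q x y n) div q n"

definition odo_add :: "(nat \<Rightarrow> nat) \<Rightarrow> (nat \<Rightarrow> nat) \<Rightarrow> (nat \<Rightarrow> nat) \<Rightarrow> nat \<Rightarrow> nat" where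
  "odo_add q x y n = (x n + y n + odo_carry q x y n) mod q n"

definition odometer :: "(nat \<Rightarrow> nat) \<Rightarrow> (nat \<Rightarrow> nat) monoid" where
  "odometer q = \<lparr>carrier = (\<Pi>\<^sub>E n\<in>UNIV. {..<q n}), mult = odo_add q, one = (\<lambda>_. 0)\<rparr>"

definition odo_topology :: "(nat \<Rightarrow> nat) \<Rightarrow> (nat \<Rightarrow> nat) topology" where
  "odo_topology q = product_topology (\<lambda>n. discrete_topology {..<q n}) UNIV"

text \<open>
  \<open>odo_tau q k\<close> is the \<open>k\<close>-th power (an integer power) of \<open>(1, 0, 0, \<dots>)\<close> in the group
  \<open>odometer q\<close>; this is the homomorphism from the integers that maps \<open>1\<close> to \<open>(1, 0, 0, \<dots>)\<close>.
\<close>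

definition odo_tau :: "(nat \<Rightarrow> nat) \<Rightarrow> int \<Rightarrow> nat \<Rightarrow> nat" where
  "odo_tau q k = (\<lambda>n. if n = 0 then 1 else 0) [^]\<^bsub>odometer q\<^esub> k"


section \<open>Normalized Haar measure of a compact group\<close>

definition borel_algebra :: "'a topology \<Rightarrow> 'a measure" where
  "borel_algebra T = sigma (topspace T) {U. openin T U}"

text \<open>The topology is assumed to be metrizable, so that regularity need not be demanded.\<close>

definition is_normalized_haar :: "('a, 'b) monoid_scheme \<Rightarrow> 'a topology \<Rightarrow> 'a measure \<Rightarrow> bool" where
  "is_normalized_haar G T M \<longleftrightarrow>
     sets M = sets (borel_algebra T) \<and>
     emeasure M (space M) = 1 \<and>
     (\<forall>A\<in>sets M. \<forall>\<xi>\<in>carrier G. emeasure M (A #>\<^bsub>G\<^esub> \<xi>) = emeasure M A)"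

definition normalized_haar :: "('a, 'b) monoid_scheme \<Rightarrow> 'a topology \<Rightarrow> 'a measure" where
  "normalized_haar G T = (THE M. is_normalized_haar G T M)"


section \<open>Windows\<close>

definition generic_window :: "(nat \<Rightarrow> nat) \<Rightarrow> (nat \<Rightarrow> nat) set \<Rightarrow> bool" where
  "generic_window q W \<longleftrightarrow> (odo_topology q frontier_of W) \<inter> range (odo_tau q) = {}"

definition proper_window :: "(nat \<Rightarrow> nat) \<Rightarrow> (nat \<Rightarrow> nat) set \<Rightarrow> bool" where
  "proper_window q W \<longleftrightarrow>
     compactin (odo_topology q) W \<and>
     W = odo_topology q closure_of (odo_topology q interior_of W)"

definition irredundant_window :: "(nat \<Rightarrow> nat) \<Rightarrow> (nat \<Rightarrow> nat) set \<Rightarrow> bool" where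
  "irredundant_window q W \<longleftrightarrow>
     (\<forall>\<xi>\<in>carrier (odometer q). W #>\<^bsub>odometer q\<^esub> \<xi> = W \<longrightarrow> \<xi> = \<one>\<^bsub>odometer q\<^esub>)"

definition regular_window :: "(nat \<Rightarrow> nat) \<Rightarrow> (nat \<Rightarrow> nat) set \<Rightarrow> bool" where
  "regular_window q W \<longleftrightarrow>
     emeasure (normalized_haar (odometer q) (odo_topology q)) (odo_topology q frontier_of W) = 0"

definition W_reg :: "(nat \<Rightarrow> nat) \<Rightarrow> (nat \<Rightarrow> nat) set set" where
  "W_reg q =
     {W \<in> sets (borel_algebra (odo_topology q)).
        generic_window q W \<and> proper_window q W \<and> irredundant_window q W \<and> regular_window q W}"


section \<open>Orbit closures in the full shift\<close>

definition full_shift :: "(int \<Rightarrow> nat) topology" where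
  "full_shift = product_topology (\<lambda>_. discrete_topology {0, 1}) UNIV"

definition orbit_closure :: "(int \<Rightarrow> nat) \<Rightarrow> (int \<Rightarrow> nat) set" where
  "orbit_closure x = full_shift closure_of range (\<lambda>n k. x (k + n))"

definition window_sequence :: "(nat \<Rightarrow> nat) \<Rightarrow> (nat \<Rightarrow> nat) set \<Rightarrow> int \<Rightarrow> nat" where
  "window_sequence q W = indicator W \<circ> odo_tau q"


section \<open>Upper box dimension\<close>

definition separated_set :: "('a \<Rightarrow> 'a \<Rightarrow> real) \<Rightarrow> real \<Rightarrow> 'a set \<Rightarrow> bool" where
  "separated_set d \<epsilon> A \<longleftrightarrow> (\<forall>x\<in>A. \<forall>y\<in>A. x \<noteq> y \<longrightarrow> \<epsilon> \<le> d x y)"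

definition sep_number :: "'a set \<Rightarrow> ('a \<Rightarrow> 'a \<Rightarrow> real) \<Rightarrow> real \<Rightarrow> enat" where
  "sep_number Z d \<epsilon> =
     (SUP A\<in>{A. A \<subseteq> Z \<and> separated_set d \<epsilon> A}. if finite A then enat (card A) else \<infinity>)"

definition log_enat :: "enat \<Rightarrow> ereal" where
  "log_enat N = (case N of enat n \<Rightarrow> if n = 0 then -\<infinity> else ereal (ln (real n)) | \<infinity> \<Rightarrow> \<infinity>)"

definition upper_box_dim :: "'a set \<Rightarrow> ('a \<Rightarrow> 'a \<Rightarrow> real) \<Rightarrow> ereal" where
  "upper_box_dim Z d = Limsup (at_right 0) (\<lambda>\<epsilon>. log_enat (sep_number Z d \<epsilon>) / ereal (- ln \<epsilon>))"


section \<open>Upper amorphic complexity\<close>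

definition folner_sequence :: "(nat \<Rightarrow> int set) \<Rightarrow> bool" where
  "folner_sequence F \<longleftrightarrow>
     (\<forall>n. finite (F n) \<and> F n \<noteq> {}) \<and>
     (\<forall>g. (\<lambda>n. real (card (sym_diff ((\<lambda>h. g + h) ` F n) (F n))) / real (card (F n))) \<longlonglongrightarrow> 0)"

text \<open>The limit superior is at most \<open>1\<close>, so nothing is lost by passing to the reals.\<close>

definition D_F :: "(nat \<Rightarrow> int set) \<Rightarrow> (int \<Rightarrow> nat) \<Rightarrow> (int \<Rightarrow> nat) \<Rightarrow> real" where
  "D_F F x y =
     real_of_ereal (limsup (\<lambda>n. ereal (real (card {g \<in> F n. x g \<noteq> y g}) / real (card (F n)))))"

definition D_F_rel :: "(nat \<Rightarrow> int set) \<Rightarrow> ((int \<Rightarrow> nat) \<times> (int \<Rightarrow> nat)) set" where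
  "D_F_rel F = {(x, y). x \<in> topspace full_shift \<and> y \<in> topspace full_shift \<and> D_F F x y = 0}"

text \<open>
  Points of \<open>D_F_quotient F X\<close> are equivalence classes in the full shift. The pseudometric
  \<open>D_F F\<close> is constant on products of two such classes, so the image in the definition of
  \<open>D_F_dist\<close> is a singleton.
\<close>

definition D_F_quotient :: "(nat \<Rightarrow> int set) \<Rightarrow> (int \<Rightarrow> nat) set \<Rightarrow> (int \<Rightarrow> nat) set set" where
  "D_F_quotient F X = (\<lambda>x. D_F_rel F `` {x}) ` X"

definition D_F_dist :: "(nat \<Rightarrow> int set) \<Rightarrow> (int \<Rightarrow> nat) set \<Rightarrow> (int \<Rightarrow> nat) set \<Rightarrow> real" where
  "D_F_dist F A B = the_elem ((\<lambda>(x, y). D_F F x y) ` (A \<times> B))"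

definition upper_amorphic_complexity :: "(nat \<Rightarrow> int set) \<Rightarrow> (int \<Rightarrow> nat) set \<Rightarrow> ereal" where
  "upper_amorphic_complexity F X = upper_box_dim (D_F_quotient F X) (D_F_dist F)"

end

theory Submission
  imports
    Defs
    "HOL-Probability.Infinite_Product_Measure"
    "HOL-Number_Theory.Cong"
    "HOL-Real_Asymp.Real_Asymp"
begin

text \<open>
  The boundary of the window must have box dimension \<open>0\<close> for every metric on the odometer, which suggests
  a boundary that consists of a single point; then the claim on the dimension is immediate
  (\<open>upper_box_dim_singleton\<close>). The boundary point is \<open>ones = (1, 1, 1, \<dots>)\<close>, and the window consists of
  this point and clopen pieces that accumulate only there. The piece at distance \<open>n\<close> consists of points with digits
  \<open>1\<close> below place \<open>n\<close> and a digit \<open>d \<noteq> 1\<close> at place \<open>n\<close>.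

  Infinite complexity comes from the freedom to choose these pieces. As \<open>q (n + 1) = 2 ^ (q n - 1)\<close>, a
  digit at place \<open>n + 1\<close> is a string of \<open>q n - 1\<close> bits, and there are exactly \<open>q n - 1\<close> digits \<open>d \<noteq> 1\<close>. Let
  \<open>d\<close> select one bit of the next digit, and let this bit decide membership in the window. Write
  \<open>Q n = q 0 * \<dots> * q (n - 1)\<close>. Translation by \<open>j * Q (n + 1)\<close> rotates the digit at place \<open>n + 1\<close> by \<open>j\<close>.
  For \<open>j \<noteq> j'\<close> and any digit \<open>m\<close> the bit strings of \<open>m + j\<close> and \<open>m + j'\<close> differ in some position, so the two
  translates of the window differ on some cylinder with digits \<open>1, \<dots>, 1, d, m\<close>. Over all \<open>m\<close> this
  gives a difference of density at least \<open>q (n + 1) / Q (n + 2) = 1 / Q (n + 1)\<close> along every Folner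
  sequence (\<open>D_F_translates_ge\<close>). So there are \<open>q (n + 1)\<close> points that are separated at scale
  \<open>1 / Q (n + 1)\<close>, and \<open>ln (q (n + 1)) / ln (Q (n + 1))\<close> tends to infinity because \<open>Q (n + 1) \<le> (q n) ^ 3\<close>
  (\<open>growth\<close>, \<open>upper_amorphic_complexity_window\<close>).

  That the window belongs to \<open>W_reg q\<close> (\<open>window_in_W_reg\<close>) also rests on the single boundary point: it
  does not come from an integer, it is a null set, and a translation that preserves the window must fix
  it. All computations with carries are replaced by computations with the residues \<open>odo_val q n x\<close>, which
  identify the odometer with an inverse limit of cyclic groups. The normalized Haar measure is handled
  through the cylinders, the fibres of \<open>odo_val q n\<close>: invariance amounts to giving all cylinders of a level
  the same mass.
\<close>

section \<open>The odometer as an inverse limit of cyclic groups\<close>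

definition odo_period :: "(nat \<Rightarrow> nat) \<Rightarrow> nat \<Rightarrow> int" where
  "odo_period q n = (\<Prod>i<n. int (q i))"

text \<open>
  The first \<open>n\<close> digits of \<open>x\<close>, read as an integer in mixed radix. For a point of the odometer it
  represents the image of \<open>x\<close> in the cyclic group of order \<open>odo_period q n\<close>, so that carry-over addition
  turns into addition of residues.
\<close>

definition odo_val :: "(nat \<Rightarrow> nat) \<Rightarrow> nat \<Rightarrow> (nat \<Rightarrow> nat) \<Rightarrow> int" where
  "odo_val q n x = (\<Sum>i<n. int (x i) * odo_period q i)"

lemma odo_period_0 [simp]: "odo_period q 0 = 1"
  and odo_period_Suc: "odo_period q (Suc n) = odo_period q n * int (q n)"
  by (simp_all add: odo_period_def)

lemma odo_val_0 [simp]: "odo_val q 0 x = 0"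
  and odo_val_Suc: "odo_val q (Suc n) x = odo_val q n x + int (x n) * odo_period q n"
  by (simp_all add: odo_val_def)

lemma odo_val_cong: "(\<And>i. i < n \<Longrightarrow> x i = y i) \<Longrightarrow> odo_val q n x = odo_val q n y"
  by (simp add: odo_val_def)

text \<open>
  Adding the first \<open>n\<close> digits by hand produces the digits of the sum and one carry into place \<open>n\<close>,
  which is worth \<open>odo_period q n\<close>. Hence the carry disappears modulo \<open>odo_period q n\<close>.
\<close>

lemma odo_val_add_carry:
  "odo_val q n (odo_add q x y) + int (odo_carry q x y n) * odo_period q n
     = odo_val q n x + odo_val q n y"
proof (induction n)
  case (Suc n)
  define s where "s = x n + y n + odo_carry q x y n"
  have "int (odo_add q x y n) * odo_period q n
          + int (odo_carry q x y (Suc n)) * odo_period q (Suc n)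
        = int (s mod q n + s div q n * q n) * odo_period q n"
    by (simp only: odo_add_def odo_carry.simps odo_period_Suc of_nat_add of_nat_mult s_def[symmetric])
       (simp only: ring_distribs mult_ac)
  also have "\<dots> = (int (x n) + int (y n) + int (odo_carry q x y n)) * odo_period q n"
    by (simp only: mod_div_mult_eq s_def of_nat_add)
  finally show ?case
    using Suc by (simp add: odo_val_Suc algebra_simps)
qed simp

text \<open>
  Radices of at least \<open>2\<close> are needed for \<open>(1, 0, 0, \<dots>)\<close> to be a point of the odometer and for the
  cylinders to shrink.
\<close>

locale odometer_radix =
  fixes q :: "nat \<Rightarrow> nat"
  assumes radix_ge_2: "2 \<le> q n"
begin

abbreviation H :: "(nat \<Rightarrow> nat) monoid" where "H \<equiv> odometer q"
abbreviation Q :: "nat \<Rightarrow> int" where "Q \<equiv> odo_period q"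
abbreviation val :: "nat \<Rightarrow> (nat \<Rightarrow> nat) \<Rightarrow> int" where "val \<equiv> odo_val q"

lemma radix_pos [simp]: "0 < q n"
  using radix_ge_2[of n] by linarith

lemma carrier_iff: "x \<in> carrier H \<longleftrightarrow> (\<forall>n. x n < q n)"
  by (auto simp: odometer_def PiE_iff)

lemma Q_pos [simp]: "0 < Q n"
  by (simp add: odo_period_def prod_pos)

lemma Q_nonzero [simp]: "Q n \<noteq> 0"
  using Q_pos[of n] by linarith

lemma Q_ge_power: "2 ^ n \<le> Q n"
proof (induction n)
  case (Suc n)
  have "(2::int) ^ n * 2 \<le> Q n * int (q n)"
    using Suc radix_ge_2[of n] by (intro mult_mono) (auto simp: less_imp_le)
  then show ?case
    by (simp add: odo_period_Suc mult.commute)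
qed simp

lemma Q_dvd_Suc: "Q n dvd Q (Suc n)"
  by (simp add: odo_period_Suc)

lemma val_nonneg: "0 \<le> val n x"
  by (simp add: odo_val_def sum_nonneg less_imp_le)

lemma val_less: "x \<in> carrier H \<Longrightarrow> val n x < Q n"
proof (induction n)
  case (Suc n)
  then have "x n < q n"
    by (simp add: carrier_iff)
  then have "int (x n) + 1 \<le> int (q n)"
    by linarith
  then have "(int (x n) + 1) * Q n \<le> int (q n) * Q n"
    by (intro mult_right_mono) (auto simp: less_imp_le)
  with Suc show ?case
    by (simp add: odo_val_Suc odo_period_Suc algebra_simps)
qed simp

lemma val_mod: "x \<in> carrier H \<Longrightarrow> val n x mod Q n = val n x"
  by (simp add: val_nonneg val_less)

lemma val_Suc_div: "x \<in> carrier H \<Longrightarrow> val (Suc n) x div Q n = int (x n)"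
  and val_Suc_mod: "x \<in> carrier H \<Longrightarrow> val (Suc n) x mod Q n = val n x"
  by (simp_all add: odo_val_Suc val_nonneg val_less)

lemma val_eq_iff:
  assumes "x \<in> carrier H" "y \<in> carrier H"
  shows "val n x = val n y \<longleftrightarrow> (\<forall>i<n. x i = y i)"
proof (induction n)
  case (Suc n)
  have "val (Suc n) x = val (Suc n) y \<longleftrightarrow> val n x = val n y \<and> x n = y n"
  proof
    assume eq: "val (Suc n) x = val (Suc n) y"
    then have "val n x = val n y"
      using val_Suc_mod[OF assms(1)] val_Suc_mod[OF assms(2)] by metis
    moreover have "int (x n) = int (y n)"
      using val_Suc_div[OF assms(1)] val_Suc_div[OF assms(2)] eq by metis
    ultimately show "val n x = val n y \<and> x n = y n"
      by simp
  qed (simp add: odo_val_Suc)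
  with Suc show ?case
    by (auto simp: less_Suc_eq)
qed simp

lemma odometer_eqI:
  assumes "x \<in> carrier H" "y \<in> carrier H" "\<And>n. val n x = val n y"
  shows "x = y"
  using assms val_eq_iff[OF assms(1,2)] by blast

text \<open>
  Completeness of the inverse limit: every compatible family of residues is realized by a point.
\<close>

lemma ex_odometer_val:
  assumes "\<And>n. 0 \<le> v n" "\<And>n. v n < Q n" "\<And>n. v (Suc n) mod Q n = v n"
  shows "\<exists>x\<in>carrier H. \<forall>n. val n x = v n"
proof (intro bexI allI)
  define x where "x = (\<lambda>n. nat (v (Suc n) div Q n))"
  have x: "int (x n) = v (Suc n) div Q n" for n
    using assms(1)[of "Suc n"] by (simp add: x_def pos_imp_zdiv_nonneg_iff)
  show "val n x = v n" for n
  proof (induction n)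
    case 0
    show ?case
      using assms(1)[of 0] assms(2)[of 0] by simp
  next
    case (Suc n)
    then show ?case
      using div_mult_mod_eq[of "v (Suc n)" "Q n"] assms(3)[of n] by (simp add: odo_val_Suc x)
  qed
  show "x \<in> carrier H"
  proof (unfold carrier_iff, intro allI)
    fix n
    have "v (Suc n) < int (q n) * Q n"
      using assms(2)[of "Suc n"] by (simp add: odo_period_Suc mult.commute)
    moreover have "v (Suc n) div Q n * Q n \<le> v (Suc n)"
      using div_mult_mod_eq[of "v (Suc n)" "Q n"] pos_mod_sign[OF Q_pos, of "v (Suc n)" n]
      by linarith
    ultimately have "v (Suc n) div Q n * Q n < int (q n) * Q n"
      by linarith
    then have "v (Suc n) div Q n < int (q n)"
      using Q_pos[of n] by (simp add: mult_less_cancel_right)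
    then show "x n < q n"
      by (simp flip: x)
  qed
qed

lemma mult_closed: "x \<otimes>\<^bsub>H\<^esub> y \<in> carrier H"
  and one_in_carrier: "\<one>\<^bsub>H\<^esub> \<in> carrier H"
  unfolding carrier_iff by (simp_all add: odometer_def odo_add_def)

lemma val_mult [simp]: "val n (x \<otimes>\<^bsub>H\<^esub> y) = (val n x + val n y) mod Q n"
proof -
  have "(val n x + val n y) mod Q n = val n (odo_add q x y) mod Q n"
    by (simp flip: odo_val_add_carry)
  then show ?thesis
    using val_mod[OF mult_closed, of n x y] by (simp add: odometer_def)
qed

lemma val_one [simp]: "val n \<one>\<^bsub>H\<^esub> = 0"
  by (simp add: odo_val_def odometer_def)

text \<open>
  All group laws are inherited from the cyclic quotients, because a point is determined by its
  residues; the inverse exists because the residues \<open>- val n x\<close> are compatible.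
\<close>

lemma group_odometer: "group H"
proof (rule groupI)
  show "\<one>\<^bsub>H\<^esub> \<in> carrier H"
    by (rule one_in_carrier)
  fix x assume x: "x \<in> carrier H"
  show "\<one>\<^bsub>H\<^esub> \<otimes>\<^bsub>H\<^esub> x = x"
    by (rule odometer_eqI) (simp_all add: x mult_closed val_mod)
  have "\<exists>y\<in>carrier H. \<forall>n. val n y = (- val n x) mod Q n"
  proof (rule ex_odometer_val)
    fix n
    have "(- val (Suc n) x) mod Q n = (- (val (Suc n) x mod Q n)) mod Q n"
      by (simp add: mod_minus_eq)
    then show "(- val (Suc n) x) mod Q (Suc n) mod Q n = (- val n x) mod Q n"
      by (simp add: mod_mod_cancel Q_dvd_Suc val_Suc_mod x)
  qed auto
  then obtain y where y: "y \<in> carrier H" "\<And>n. val n y = (- val n x) mod Q n"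
    by blast
  have "y \<otimes>\<^bsub>H\<^esub> x = \<one>\<^bsub>H\<^esub>"
    by (rule odometer_eqI) (simp_all add: y one_in_carrier mult_closed mod_simps)
  with y show "\<exists>y\<in>carrier H. y \<otimes>\<^bsub>H\<^esub> x = \<one>\<^bsub>H\<^esub>"
    by blast
next
  fix x y z assume "x \<in> carrier H" "y \<in> carrier H" "z \<in> carrier H"
  show "x \<otimes>\<^bsub>H\<^esub> y \<otimes>\<^bsub>H\<^esub> z = x \<otimes>\<^bsub>H\<^esub> (y \<otimes>\<^bsub>H\<^esub> z)"
    by (rule odometer_eqI) (simp_all add: mult_closed mod_simps add.assoc)
qed (rule mult_closed)

sublocale group H
  by (rule group_odometer)

lemma gen_in_carrier: "(\<lambda>n. if n = 0 then 1 else 0) \<in> carrier H"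
  using radix_ge_2[of 0] by (simp add: carrier_iff)

lemma odo_tau_in_carrier: "odo_tau q k \<in> carrier H"
  by (simp add: odo_tau_def gen_in_carrier)

text \<open>
  The homomorphism \<open>odo_tau q\<close> is reduction of an integer modulo all periods simultaneously. For
  negative \<open>k\<close> this uses that \<open>odo_tau q k\<close> is inverse to \<open>odo_tau q (- k)\<close>.
\<close>

lemma val_tau: "val n (odo_tau q k) = k mod Q n"
proof -
  have gen: "val n (\<lambda>i. if i = 0 then 1 else 0) = 1 mod Q n"
  proof (cases n)
    case (Suc m)
    have "2 ^ n \<le> Q n"
      by (rule Q_ge_power)
    moreover have "(2::int) \<le> 2 ^ n"
      using Suc by simp
    ultimately have "1 mod Q n = 1"
      by simp
    then show ?thesis
      by (simp add: odo_val_def Suc lessThan_Suc_eq_insert_0 sum.reindex del: sum.lessThan_Suc)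
  qed simp
  have nat_pow: "val n ((\<lambda>i. if i = 0 then 1 else 0) [^]\<^bsub>H\<^esub> (m::nat)) = int m mod Q n" for m
    by (induction m) (simp_all add: gen mod_simps add.commute)
  show ?thesis
  proof (cases "k < 0")
    case False
    then show ?thesis
      unfolding odo_tau_def int_pow_def2 using nat_pow[of "nat k"] by simp
  next
    case True
    let ?g = "(\<lambda>i. if i = 0 then 1 else 0) [^]\<^bsub>H\<^esub> nat (- k)"
    have "odo_tau q k \<otimes>\<^bsub>H\<^esub> ?g = \<one>\<^bsub>H\<^esub>"
      unfolding odo_tau_def int_pow_def2
      using l_inv[OF nat_pow_closed[OF gen_in_carrier], of "nat (- k)"] True by simp
    then have "0 = (val n (odo_tau q k) + val n ?g) mod Q n"
      by (metis val_mult val_one)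
    also have "\<dots> = (val n (odo_tau q k) - k) mod Q n"
      unfolding nat_pow using True by (simp add: mod_simps)
    finally have "val n (odo_tau q k) mod Q n = k mod Q n"
      by (simp add: mod_eq_dvd_iff dvd_eq_mod_eq_0)
    then show ?thesis
      by (simp add: val_mod odo_tau_in_carrier)
  qed
qed

lemma odo_tau_digit: "int (odo_tau q k n) = k div Q n mod int (q n)"
proof -
  have "int (odo_tau q k n) = k mod Q (Suc n) div Q n"
    using val_Suc_div[OF odo_tau_in_carrier] by (simp add: val_tau)
  also have "\<dots> = k div Q n mod int (q n)"
    by (simp add: odo_period_Suc zmod_zmult2_eq)
  finally show ?thesis .
qed

end

section \<open>The topology of the odometer\<close>

context odometer_radix
begin

abbreviation T :: "(nat \<Rightarrow> nat) topology" where "T \<equiv> odo_topology q"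

definition cyl :: "nat \<Rightarrow> int \<Rightarrow> (nat \<Rightarrow> nat) set" where
  "cyl n v = {x \<in> carrier H. val n x = v}"

lemma topspace_odo [simp]: "topspace T = carrier H"
  by (simp add: odo_topology_def odometer_def)

text \<open>
  A basic open set of the product restricts finitely many coordinates, hence only coordinates below
  some \<open>n\<close>, and \<open>val n\<close> records precisely those.
\<close>

lemma openin_odo_iff:
  "openin T U \<longleftrightarrow> U \<subseteq> carrier H \<and> (\<forall>x\<in>U. \<exists>n. cyl n (val n x) \<subseteq> U)"
proof
  assume U: "openin T U"
  have "\<exists>n. cyl n (val n x) \<subseteq> U" if "x \<in> U" for x
  proof -
    obtain V where V: "finite {i \<in> UNIV. V i \<noteq> topspace (discrete_topology {..<q i})} \<and>
        (\<forall>i\<in>UNIV. openin (discrete_topology {..<q i}) (V i)) \<and> x \<in> Pi\<^sub>E UNIV V \<and> Pi\<^sub>E UNIV V \<subseteq> U"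
      using U[unfolded odo_topology_def openin_product_topology_alt, THEN bspec, OF \<open>x \<in> U\<close>] ..
    then have fin: "finite {i. V i \<noteq> {..<q i}}"
      and x: "x \<in> Pi\<^sub>E UNIV V" and sub: "Pi\<^sub>E UNIV V \<subseteq> U"
      by simp_all
    obtain n where n: "\<And>i. V i \<noteq> {..<q i} \<Longrightarrow> i < n"
      using finite_nat_set_iff_bounded[THEN iffD1, OF fin] by blast
    have "y \<in> Pi\<^sub>E UNIV V" if "y \<in> cyl n (val n x)" for y
    proof -
      have y: "y \<in> carrier H" "val n y = val n x"
        using that by (auto simp: cyl_def)
      have "x \<in> carrier H"
        using \<open>x \<in> U\<close> openin_subset[OF U] by auto
      then have eq: "y i = x i" if "i < n" for i
        using y that val_eq_iff by blast
      have "y i \<in> V i" for i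
      proof (cases "i < n")
        case True
        then show ?thesis
          using eq x by auto
      next
        case False
        then have "V i = {..<q i}"
          using n by blast
        then show ?thesis
          using y by (simp add: carrier_iff)
      qed
      then show ?thesis by auto
    qed
    with sub show ?thesis by blast
  qed
  with openin_subset[OF U] show "U \<subseteq> carrier H \<and> (\<forall>x\<in>U. \<exists>n. cyl n (val n x) \<subseteq> U)"
    by simp
next
  assume U: "U \<subseteq> carrier H \<and> (\<forall>x\<in>U. \<exists>n. cyl n (val n x) \<subseteq> U)"
  show "openin T U"
    unfolding odo_topology_def openin_product_topology_alt
  proof
    fix x assume x: "x \<in> U"
    then obtain n where n: "cyl n (val n x) \<subseteq> U"
      using U by blast
    have xH: "x \<in> carrier H"
      using x U by blast
    define V where "V = (\<lambda>i. if i < n then {x i} else {..<q i})"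
    have "{i. V i \<noteq> {..<q i}} \<subseteq> {..<n}"
      by (auto simp: V_def)
    then have "finite {i. V i \<noteq> {..<q i}}"
      using finite_subset by blast
    moreover have "openin (discrete_topology {..<q i}) (V i)" for i
      using xH by (auto simp: V_def carrier_iff)
    moreover have "x \<in> Pi\<^sub>E UNIV V"
      using xH by (auto simp: V_def carrier_iff)
    moreover have "Pi\<^sub>E UNIV V \<subseteq> U"
    proof
      fix y assume "y \<in> Pi\<^sub>E UNIV V"
      then have y: "y i \<in> V i" for i
        by auto
      have "y i < q i" for i
        using y[of i] xH by (auto simp: V_def carrier_iff split: if_splits)
      then have yH: "y \<in> carrier H"
        by (simp add: carrier_iff)
      have "y i = x i" if "i < n" for i
        using y[of i] that by (simp add: V_def)
      then have "y \<in> cyl n (val n x)"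
        using yH odo_val_cong[of n y x q] by (simp add: cyl_def)
      with n show "y \<in> U" by blast
    qed
    ultimately show "\<exists>V. finite {i \<in> UNIV. V i \<noteq> topspace (discrete_topology {..<q i})} \<and>
        (\<forall>i\<in>UNIV. openin (discrete_topology {..<q i}) (V i)) \<and> x \<in> Pi\<^sub>E UNIV V \<and> Pi\<^sub>E UNIV V \<subseteq> U"
      by (intro exI[of _ V]) simp
  qed
qed

lemma openin_cyl: "openin T (cyl n v)"
  unfolding openin_odo_iff by (auto simp: cyl_def)

lemma val_mod_le:
  assumes "x \<in> carrier H" "m \<le> n"
  shows "val n x mod Q m = val m x"
  using assms(2)
proof (induction n rule: dec_induct)
  case base
  show ?case
    by (rule val_mod[OF assms(1)])
next
  case (step n)
  have "Q m dvd Q n"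
    using step.hyps unfolding odo_period_def by (intro prod_dvd_prod_subset) auto
  then have "val (Suc n) x mod Q m = val (Suc n) x mod Q n mod Q m"
    by (simp add: mod_mod_cancel)
  then show ?case
    using step.IH by (simp add: val_Suc_mod[OF assms(1)])
qed

lemma compact_odo: "compact_space T"
  unfolding odo_topology_def compact_space_product_topology
  by (simp add: compact_space_discrete_topology)

section \<open>The Haar measure of the odometer\<close>

definition cylinders :: "(nat \<Rightarrow> nat) set set" where
  "cylinders = range (\<lambda>(n, v). cyl n v)"

lemma cyl_in_cylinders [simp]: "cyl n v \<in> cylinders"
  by (auto simp: cylinders_def image_iff)

lemma cylinders_subset: "cylinders \<subseteq> Pow (carrier H)"
  by (auto simp: cylinders_def cyl_def)

lemma countable_cylinders: "countable cylinders"
  by (simp add: cylinders_def)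

lemma Int_cyl_le: "m \<le> n \<Longrightarrow> cyl m v \<inter> cyl n w \<in> cylinders"
proof -
  assume mn: "m \<le> n"
  have "cyl m v \<inter> cyl n w = (if w mod Q m = v then cyl n w else cyl 0 1)"
    using val_mod_le[OF _ mn] by (auto simp: cyl_def)
  then show ?thesis by simp
qed

text \<open>
  Two cylinders are nested or disjoint, and the empty set is a cylinder (for a \<open>v\<close> that is not a value
  of \<open>val n\<close>).
\<close>

lemma Int_stable_cylinders: "Int_stable cylinders"
proof (rule Int_stableI)
  fix A B assume "A \<in> cylinders" "B \<in> cylinders"
  then obtain m v n w where AB: "A = cyl m v" "B = cyl n w"
    by (auto simp: cylinders_def)
  show "A \<inter> B \<in> cylinders"
    using Int_cyl_le[of m n v w] Int_cyl_le[of n m w v] by (cases "m \<le> n") (auto simp: AB Int_commute)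
qed

text \<open>
  There are only countably many cylinders, so every open set is a countable union of them.
\<close>

lemma sets_borel: "sets (borel_algebra T) = sigma_sets (carrier H) cylinders"
proof -
  have "sets (borel_algebra T) = sigma_sets (carrier H) {U. openin T U}"
    unfolding borel_algebra_def topspace_odo
    by (rule sets_measure_of) (auto simp: openin_odo_iff)
  also have "\<dots> = sigma_sets (carrier H) cylinders"
  proof (rule sigma_sets_eqI)
    fix U assume "U \<in> {U. openin T U}"
    then have U: "openin T U" by simp
    have "U = \<Union>{C \<in> cylinders. C \<subseteq> U}"
    proof (intro subset_antisym subsetI)
      fix x assume x: "x \<in> U"
      then obtain n where "cyl n (val n x) \<subseteq> U" "x \<in> carrier H"
        using U by (meson openin_odo_iff subset_iff)
      then have "cyl n (val n x) \<in> {C \<in> cylinders. C \<subseteq> U}" "x \<in> cyl n (val n x)"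
        using \<open>x \<in> carrier H\<close> by (simp, simp add: cyl_def)
      then show "x \<in> \<Union>{C \<in> cylinders. C \<subseteq> U}"
        by blast
    qed auto
    moreover have "\<Union>{C \<in> cylinders. C \<subseteq> U} \<in> sigma_sets (carrier H) cylinders"
      using countable_cylinders by (intro sigma_sets_UNION) (auto intro: countable_subset)
    ultimately show "U \<in> sigma_sets (carrier H) cylinders"
      by simp
  next
    fix C assume "C \<in> cylinders"
    then show "C \<in> sigma_sets (carrier H) {U. openin T U}"
      using openin_cyl by (auto simp: cylinders_def)
  qed
  finally show ?thesis .
qed

lemma space_borel: "sets M = sets (borel_algebra T) \<Longrightarrow> space M = carrier H"
  by (metis borel_algebra_def openin_subset topspace_odo sets_eq_imp_space_eq space_measure_of_conv)

lemma cyl_in_sets: "sets M = sets (borel_algebra T) \<Longrightarrow> cyl n v \<in> sets M"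
  by (simp add: sets_borel)

lemma r_coset_eq_vimage:
  assumes "A \<subseteq> carrier H" "\<xi> \<in> carrier H"
  shows "A #>\<^bsub>H\<^esub> \<xi> = {y \<in> carrier H. y \<otimes>\<^bsub>H\<^esub> inv\<^bsub>H\<^esub> \<xi> \<in> A}"
proof (intro subset_antisym subsetI)
  fix y assume "y \<in> A #>\<^bsub>H\<^esub> \<xi>"
  then obtain x where "x \<in> A" "y = x \<otimes>\<^bsub>H\<^esub> \<xi>"
    by (auto simp: r_coset_def)
  with assms show "y \<in> {y \<in> carrier H. y \<otimes>\<^bsub>H\<^esub> inv\<^bsub>H\<^esub> \<xi> \<in> A}"
    by (auto simp: m_assoc subset_iff)
next
  fix y assume y: "y \<in> {y \<in> carrier H. y \<otimes>\<^bsub>H\<^esub> inv\<^bsub>H\<^esub> \<xi> \<in> A}"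
  then have "y = y \<otimes>\<^bsub>H\<^esub> inv\<^bsub>H\<^esub> \<xi> \<otimes>\<^bsub>H\<^esub> \<xi>"
    using assms by (simp add: m_assoc)
  with y show "y \<in> A #>\<^bsub>H\<^esub> \<xi>"
    by (auto simp: r_coset_def)
qed

lemma val_cancel_right:
  assumes "x \<in> carrier H" "y \<in> carrier H"
  shows "val n (x \<otimes>\<^bsub>H\<^esub> \<xi>) = val n (y \<otimes>\<^bsub>H\<^esub> \<xi>) \<longleftrightarrow> val n x = val n y"
proof -
  have "val n (x \<otimes>\<^bsub>H\<^esub> \<xi>) = val n (y \<otimes>\<^bsub>H\<^esub> \<xi>) \<longleftrightarrow> val n x mod Q n = val n y mod Q n"
    by (simp add: mod_eq_dvd_iff)
  then show ?thesis
    by (simp add: val_mod assms)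
qed

text \<open>
  Translations act on the cylinders of level \<open>n\<close> in the same way as on residues modulo \<open>Q n\<close>.
\<close>

lemma cyl_eq_r_coset:
  assumes "x \<in> carrier H" "\<xi> \<in> carrier H"
  shows "cyl n (val n x) #>\<^bsub>H\<^esub> \<xi> = cyl n (val n (x \<otimes>\<^bsub>H\<^esub> \<xi>))"
proof -
  have "val n (y \<otimes>\<^bsub>H\<^esub> inv\<^bsub>H\<^esub> \<xi>) = val n x \<longleftrightarrow> val n y = val n (x \<otimes>\<^bsub>H\<^esub> \<xi>)"
    if "y \<in> carrier H" for y
    using val_cancel_right[of "y \<otimes>\<^bsub>H\<^esub> inv\<^bsub>H\<^esub> \<xi>" x n \<xi>] assms that by (simp add: m_assoc del: val_mult)
  moreover have "cyl n (val n x) \<subseteq> carrier H"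
    by (auto simp: cyl_def)
  ultimately show ?thesis
    using assms by (subst r_coset_eq_vimage) (auto simp: cyl_def simp del: val_mult)
qed

lemma cyl_cases:
  obtains "cyl n v = {}" | x where "x \<in> carrier H" "v = val n x"
  by (auto simp: cyl_def)

lemma ex_carrier_val: "0 \<le> v \<Longrightarrow> v < Q n \<Longrightarrow> val n (odo_tau q v) = v"
  by (simp add: val_tau)

lemma borel_measure_eqI:
  assumes "sets M = sets (borel_algebra T)" "sets N = sets (borel_algebra T)"
    and "\<And>n x. x \<in> carrier H \<Longrightarrow> emeasure M (cyl n (val n x)) = emeasure N (cyl n (val n x))"
    and "emeasure M (space M) \<noteq> \<infinity>"
  shows "M = N"
proof (rule measure_eqI_generator_eq[OF Int_stable_cylinders cylinders_subset])
  fix C assume "C \<in> cylinders"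
  then obtain n v where C: "C = cyl n v"
    by (auto simp: cylinders_def)
  show "emeasure M C = emeasure N C"
    unfolding C by (rule cyl_cases[of n v]) (simp_all add: assms(3))
next
  have "cyl 0 0 = carrier H"
    by (simp add: cyl_def)
  then show "range (\<lambda>_::nat. carrier H) \<subseteq> cylinders"
    using cyl_in_cylinders[of 0 0] by auto
qed (use assms space_borel[OF assms(1)] in \<open>auto simp: sets_borel\<close>)

lemma emeasure_cyl_sum:
  assumes "sets M = sets (borel_algebra T)"
    and "\<And>v. 0 \<le> v \<Longrightarrow> v < Q n \<Longrightarrow> emeasure M (cyl n v) = c"
  shows "emeasure M (space M) = of_nat (nat (Q n)) * c"
proof -
  have "space M = (\<Union>v\<in>{0..<Q n}. cyl n v)"
    unfolding space_borel[OF assms(1)] using val_nonneg val_less by (auto simp: cyl_def)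
  moreover have "emeasure M (\<Union>v\<in>{0..<Q n}. cyl n v) = (\<Sum>v\<in>{0..<Q n}. emeasure M (cyl n v))"
    by (rule sum_emeasure[symmetric])
       (auto simp: disjoint_family_on_def cyl_def[of n] intro: cyl_in_sets[OF assms(1), unfolded cyl_def])
  ultimately show ?thesis
    using assms(2) by simp
qed

text \<open>
  The \<open>Q n\<close> cylinders of level \<open>n\<close> are translates of each other and partition the odometer. This
  forces the values of a normalized Haar measure on cylinders, and hence its uniqueness.
\<close>

lemma haar_cyl:
  assumes "is_normalized_haar H T M" "x \<in> carrier H"
  shows "emeasure M (cyl n (val n x)) = ennreal (1 / real_of_int (Q n))"
proof -
  have sets: "sets M = sets (borel_algebra T)" and one: "emeasure M (space M) = 1"
    and inv: "\<And>A \<xi>. A \<in> sets M \<Longrightarrow> \<xi> \<in> carrier H \<Longrightarrow> emeasure M (A #>\<^bsub>H\<^esub> \<xi>) = emeasure M A"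
    using assms(1) by (auto simp: is_normalized_haar_def)
  define c where "c = emeasure M (cyl n (val n \<one>\<^bsub>H\<^esub>))"
  have c: "emeasure M (cyl n (val n y)) = c" if "y \<in> carrier H" for y
    using inv[OF cyl_in_sets[OF sets] that, of n "val n \<one>\<^bsub>H\<^esub>"] that
    by (simp add: cyl_eq_r_coset c_def del: val_mult val_one)
  have "emeasure M (cyl n v) = c" if "0 \<le> v" "v < Q n" for v
    using c[OF odo_tau_in_carrier, of v] ex_carrier_val[OF that] by simp
  from emeasure_cyl_sum[OF sets this] one have 1: "of_nat (nat (Q n)) * c = 1"
    by simp
  have "c = ennreal (1 / real_of_int (Q n))"
  proof -
    have "c \<noteq> \<infinity>"
      using 1 Q_pos[of n] by (auto simp: ennreal_mult_top split: if_splits)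
    then obtain r where r: "c = ennreal r" "0 \<le> r"
      by (cases c) auto
    have "ennreal (real_of_int (Q n) * r) = 1"
      using 1 r by (simp add: ennreal_of_nat_eq_real_of_nat ennreal_mult' less_imp_le)
    then have "real_of_int (Q n) * r = 1"
      by simp
    then have "r = 1 / real_of_int (Q n)"
      by (simp add: eq_divide_eq mult.commute)
    then show ?thesis
      by (simp add: r(1))
  qed
  with c[OF assms(2)] show ?thesis by simp
qed

text \<open>
  Conversely, equidistribution on cylinders implies invariance: the push-forward under a translation
  has the same values on cylinders, so it is the same measure.
\<close>

lemma is_haarI:
  assumes sets: "sets M = sets (borel_algebra T)"
    and cyl: "\<And>n x. x \<in> carrier H \<Longrightarrow> emeasure M (cyl n (val n x)) = ennreal (1 / real_of_int (Q n))"
  shows "is_normalized_haar H T M"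
  unfolding is_normalized_haar_def
proof (intro conjI ballI)
  show "sets M = sets (borel_algebra T)" by fact
  have "cyl 0 (val 0 \<one>\<^bsub>H\<^esub>) = carrier H"
    by (simp add: cyl_def)
  with cyl[of "\<one>\<^bsub>H\<^esub>" 0] show one: "emeasure M (space M) = 1"
    by (simp add: space_borel[OF sets])
  fix A \<xi> assume A: "A \<in> sets M" and \<xi>: "\<xi> \<in> carrier H"
  let ?f = "\<lambda>y. y \<otimes>\<^bsub>H\<^esub> inv\<^bsub>H\<^esub> \<xi>"
  have vim: "?f -` A \<inter> space M = A #>\<^bsub>H\<^esub> \<xi>" if "A \<subseteq> carrier H" for A
    using r_coset_eq_vimage[OF that \<xi>] by (auto simp: space_borel[OF sets])
  have f: "?f \<in> measurable M M"
  proof (rule measurable_sigma_sets[of M "carrier H" cylinders])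
    show "sets M = sigma_sets (carrier H) cylinders"
      by (simp add: sets sets_borel)
    show "?f \<in> space M \<rightarrow> carrier H"
      using \<xi> by (auto simp: space_borel[OF sets])
    fix C assume "C \<in> cylinders"
    then obtain n v where C: "C = cyl n v"
      by (auto simp: cylinders_def)
    show "?f -` C \<inter> space M \<in> sets M"
    proof (cases rule: cyl_cases[of n v])
      case (2 x)
      have "C \<subseteq> carrier H"
        by (auto simp: C cyl_def)
      then show ?thesis
        using 2 \<xi> by (simp add: vim C cyl_eq_r_coset cyl_in_sets[OF sets] del: val_mult)
    qed (simp add: C)
  qed (rule cylinders_subset)
  \<comment> \<open>The push-forward under translation by the inverse of \<open>\<xi>\<close> assigns to \<open>A\<close> the measure of \<open>A + \<xi>\<close>.\<close>
  have "distr M M ?f = M"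
  proof (rule borel_measure_eqI)
    fix n x assume x: "x \<in> carrier H"
    have "cyl n (val n x) \<subseteq> carrier H"
      by (auto simp: cyl_def)
    then show "emeasure (distr M M ?f) (cyl n (val n x)) = emeasure M (cyl n (val n x))"
      using x \<xi> cyl_in_sets[OF sets]
      by (simp add: emeasure_distr[OF f] vim cyl_eq_r_coset cyl del: val_mult)
  next
    have "carrier H #>\<^bsub>H\<^esub> \<xi> = carrier H"
      using \<xi> subgroup_self by (intro coset_join2)
    then have "?f -` space M \<inter> space M = space M"
      using vim[OF subset_refl] by (simp only: space_borel[OF sets])
    with emeasure_distr[OF f sets.top] one have "emeasure (distr M M ?f) (space M) = 1"
      by simp
    then show "emeasure (distr M M ?f) (space (distr M M ?f)) \<noteq> \<infinity>"
      by simp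
  qed (simp_all add: sets)
  then have "emeasure M A = emeasure (distr M M ?f) A"
    by simp
  also have "\<dots> = emeasure M (A #>\<^bsub>H\<^esub> \<xi>)"
    using A vim[of A] sets.sets_into_space[OF A] by (simp add: emeasure_distr[OF f] space_borel[OF sets])
  finally show "emeasure M (A #>\<^bsub>H\<^esub> \<xi>) = emeasure M A" ..
qed

text \<open>
  The product of the uniform distributions on the digits is equidistributed on cylinders.
\<close>

lemma ex_haar: "\<exists>M. is_normalized_haar H T M"
proof -
  define P where "P = (\<Pi>\<^sub>M n\<in>UNIV. uniform_count_measure {..<q n})"
  have prob: "prob_space (uniform_count_measure {..<q n})" for n
    by (rule prob_space_uniform_count_measure) (auto intro: exI[of _ 0] simp: lessThan_empty_iff)
  interpret product_prob_space "\<lambda>n. uniform_count_measure {..<q n}" UNIV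
    by (simp add: product_prob_space_def product_prob_space_axioms_def product_sigma_finite_def prob prob_space_imp_sigma_finite)
  have space: "space P = carrier H"
    by (simp add: P_def space_PiM odometer_def space_uniform_count_measure)
  have cyl_eq: "cyl n (val n x) = {y \<in> space P. \<forall>i\<in>{..<n}. y i \<in> {x i}}" if "x \<in> carrier H" for n x
    using that by (auto simp: cyl_def space val_eq_iff)
  have em: "emeasure P (cyl n (val n x)) = ennreal (1 / real_of_int (Q n))" if x: "x \<in> carrier H" for n x
  proof -
    have "emeasure P (cyl n (val n x)) = (\<Prod>i<n. emeasure (uniform_count_measure {..<q i}) {x i})"
      unfolding cyl_eq[OF x] P_def
      using x by (intro emeasure_PiM_Collect) (auto simp: sets_uniform_count_measure carrier_iff)
    also have "\<dots> = (\<Prod>i<n. ennreal (1 / real (q i)))"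
      using x by (intro prod.cong) (auto simp: emeasure_uniform_count_measure carrier_iff)
    also have "\<dots> = ennreal (\<Prod>i<n. 1 / real (q i))"
      by (simp add: prod_ennreal)
    also have "(\<Prod>i<n. 1 / real (q i)) = 1 / real_of_int (Q n)"
      by (simp add: odo_period_def prod_dividef)
    finally show ?thesis .
  qed
  have "sets P = sigma_sets (carrier H) cylinders"
  proof (intro subset_antisym)
    show "sigma_sets (carrier H) cylinders \<subseteq> sets P"
      unfolding space[symmetric]
    proof (rule sets.sigma_sets_subset, rule subsetI)
      fix C assume "C \<in> cylinders"
      then obtain n v where C: "C = cyl n v"
        by (auto simp: cylinders_def)
      show "C \<in> sets P"
      proof (cases rule: cyl_cases[of n v])
        case (2 x)
        have "{y \<in> space P. \<forall>i\<in>{..<n}. y i \<in> {x i}} \<in> sets P"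
        proof (rule sets.sets_Collect_finite_All)
          fix i assume "i \<in> {..<n}"
          have "{x i} \<in> sets (uniform_count_measure {..<q i})"
            using 2 by (simp add: sets_uniform_count_measure carrier_iff)
          then show "{y \<in> space P. y i \<in> {x i}} \<in> sets P"
                unfolding P_def by measurable
        qed simp
        then show ?thesis
          using cyl_eq[OF 2(1), of n] 2(2) C by simp
      qed (simp add: C)
    qed
    show "sets P \<subseteq> sigma_sets (carrier H) cylinders"
      unfolding P_def sets_borel[symmetric]
    proof (rule sets_PiM_in_sets)
      show "space (borel_algebra T) = (\<Pi>\<^sub>E i\<in>UNIV. space (uniform_count_measure {..<q i}))"
        by (simp add: space_borel odometer_def space_uniform_count_measure)
      fix i A assume "A \<in> sets (uniform_count_measure {..<q i})"
      have "openin T {x \<in> carrier H. x i \<in> A}"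
        unfolding openin_odo_iff
      proof (intro conjI ballI)
        fix x assume x: "x \<in> {x \<in> carrier H. x i \<in> A}"
        then have "cyl (Suc i) (val (Suc i) x) \<subseteq> {x \<in> carrier H. x i \<in> A}"
          using val_eq_iff[of _ x "Suc i"] by (auto simp: cyl_def less_Suc_eq simp del: odo_val_Suc)
        then show "\<exists>n. cyl n (val n x) \<subseteq> {x \<in> carrier H. x i \<in> A}" ..
      qed auto
      then show "{x \<in> space (borel_algebra T). x i \<in> A} \<in> sets (borel_algebra T)"
        by (auto simp: space_borel borel_algebra_def openin_odo_iff intro!: sigma_sets.Basic)
    qed
  qed
  then have "is_normalized_haar H T P"
    by (intro is_haarI) (simp_all add: em sets_borel)
  then show ?thesis ..
qed

text \<open>
  The constant \<open>normalized_haar\<close> is a definite description, so existence and uniqueness are both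
  required before anything can be said about its value.
\<close>

lemma normalized_haar_is_haar: "is_normalized_haar H T (normalized_haar H T)"
proof -
  obtain M where M: "is_normalized_haar H T M"
    using ex_haar ..
  have setsM: "sets M = sets (borel_algebra T)"
    using M unfolding is_normalized_haar_def by (rule conjunct1)
  have "N = M" if N: "is_normalized_haar H T N" for N
  proof (rule borel_measure_eqI)
    show "sets N = sets (borel_algebra T)"
      using N unfolding is_normalized_haar_def by (rule conjunct1)
    show "emeasure N (space N) \<noteq> \<infinity>"
      using N unfolding is_normalized_haar_def by simp
    show "emeasure N (cyl n (val n x)) = emeasure M (cyl n (val n x))"
      if "x \<in> carrier H" for n x
      by (simp only: haar_cyl[OF M that] haar_cyl[OF N that])
  qed (rule setsM)
  with M have "\<exists>!M. is_normalized_haar H T M"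
    by (rule ex1I)
  then show ?thesis
    unfolding normalized_haar_def by (rule theI')
qed

text \<open>
  A point lies in cylinders of measure \<open>1 / Q n\<close>, which tends to \<open>0\<close>.
\<close>

lemma haar_singleton:
  assumes "x \<in> carrier H"
  shows "emeasure (normalized_haar H T) {x} = 0"
proof -
  let ?\<nu> = "normalized_haar H T"
  have le: "emeasure ?\<nu> {x} \<le> ennreal ((1/2) ^ n)" for n
  proof -
    have sets: "sets ?\<nu> = sets (borel_algebra T)"
      using normalized_haar_is_haar by (simp add: is_normalized_haar_def)
    have "emeasure ?\<nu> {x} \<le> emeasure ?\<nu> (cyl n (val n x))"
      using assms by (intro emeasure_mono cyl_in_sets[OF sets]) (auto simp: cyl_def)
    also have "\<dots> = ennreal (1 / real_of_int (Q n))"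
      by (rule haar_cyl[OF normalized_haar_is_haar assms])
    also have "\<dots> \<le> ennreal ((1/2) ^ n)"
    proof -
      have "2 ^ n \<le> real_of_int (Q n)"
        using Q_ge_power[of n] by (metis of_int_le_iff of_int_numeral of_int_power)
      then show ?thesis
        by (intro ennreal_leI) (simp add: power_one_over field_simps frac_le)
    qed
    finally show ?thesis .
  qed
  have "(\<lambda>n. ennreal ((1/2) ^ n)) \<longlonglongrightarrow> ennreal 0"
    by (intro tendsto_ennrealI LIMSEQ_power_zero) simp
  then have "emeasure ?\<nu> {x} \<le> ennreal 0"
    by (rule LIMSEQ_le_const) (use le in blast)
  then show ?thesis by simp
qed

end

section \<open>Densities along Folner sequences\<close>

context
  fixes F :: "nat \<Rightarrow> int set"
  assumes F: "folner_sequence F"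
begin

lemma folner_finite: "finite (F n)" and folner_nonempty: "F n \<noteq> {}"
  using F by (auto simp: folner_sequence_def)

lemma folner_card_pos: "0 < real (card (F n))"
  using folner_finite folner_nonempty by (simp add: card_gt_0_iff)

definition disagreement :: "(int \<Rightarrow> nat) \<Rightarrow> (int \<Rightarrow> nat) \<Rightarrow> nat \<Rightarrow> real" where
  "disagreement x y n = real (card {g \<in> F n. x g \<noteq> y g}) / real (card (F n))"

lemma disagreement_nonneg: "0 \<le> disagreement x y n"
  and disagreement_le_1: "disagreement x y n \<le> 1"
  using folner_card_pos[of n] card_mono[OF folner_finite, of "{g \<in> F n. x g \<noteq> y g}" n]
  by (auto simp: disagreement_def divide_le_eq_1)

lemma disagreement_triangle:
  "disagreement x z n \<le> disagreement x y n + disagreement y z n"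
proof -
  have "card {g \<in> F n. x g \<noteq> z g} \<le> card ({g \<in> F n. x g \<noteq> y g} \<union> {g \<in> F n. y g \<noteq> z g})"
    using folner_finite by (intro card_mono) auto
  also have "\<dots> \<le> card {g \<in> F n. x g \<noteq> y g} + card {g \<in> F n. y g \<noteq> z g}"
    by (rule card_Un_le)
  finally have "real (card {g \<in> F n. x g \<noteq> z g})
      \<le> real (card {g \<in> F n. x g \<noteq> y g}) + real (card {g \<in> F n. y g \<noteq> z g})"
    by linarith
  then show ?thesis
    unfolding disagreement_def add_divide_distrib[symmetric]
    by (rule divide_right_mono) simp
qed

text \<open>
  The relative frequencies lie between \<open>0\<close> and \<open>1\<close>, so the conversion to a real number in the
  definition of \<open>D_F\<close> loses nothing.
\<close>

lemma ereal_D_F: "ereal (D_F F x y) = limsup (\<lambda>n. ereal (disagreement x y n))"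
proof -
  have "0 \<le> limsup (\<lambda>n. ereal (disagreement x y n))"
    by (rule le_Limsup) (simp_all add: disagreement_nonneg)
  moreover have "limsup (\<lambda>n. ereal (disagreement x y n)) \<le> 1"
    by (rule Limsup_bounded) (simp add: disagreement_le_1 one_ereal_def)
  ultimately have "\<bar>limsup (\<lambda>n. ereal (disagreement x y n))\<bar> \<noteq> \<infinity>"
    by auto
  then show ?thesis
    by (simp add: D_F_def disagreement_def ereal_real')
qed

lemma D_F_commute: "D_F F x y = D_F F y x"
proof -
  have "disagreement x y = disagreement y x"
    by (simp add: disagreement_def fun_eq_iff neq_commute)
  then have "ereal (D_F F x y) = ereal (D_F F y x)"
    by (simp only: ereal_D_F)
  then show ?thesis
    by simp
qed

lemma D_F_triangle: "D_F F x z \<le> D_F F x y + D_F F y z"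
proof -
  have "limsup (\<lambda>n. ereal (disagreement x z n))
      \<le> limsup (\<lambda>n. ereal (disagreement x y n) + ereal (disagreement y z n))"
    by (intro Limsup_mono always_eventually) (simp add: disagreement_triangle)
  also have "\<dots> \<le> limsup (\<lambda>n. ereal (disagreement x y n)) + limsup (\<lambda>n. ereal (disagreement y z n))"
    by (rule ereal_limsup_add_mono)
  finally have "ereal (D_F F x z) \<le> ereal (D_F F x y) + ereal (D_F F y z)"
    by (simp only: ereal_D_F)
  then show ?thesis
    by simp
qed

lemma D_F_self: "D_F F x x = 0"
  by (simp add: D_F_def zero_ereal_def[symmetric] Limsup_const)

lemma D_F_cong:
  assumes "D_F F x x' = 0" "D_F F y y' = 0"
  shows "D_F F x' y' = D_F F x y"
proof (rule antisym)
  show "D_F F x' y' \<le> D_F F x y"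
    using D_F_triangle[of x' y' x] D_F_triangle[of x y' y] assms D_F_commute[of x' x] by linarith
  show "D_F F x y \<le> D_F F x' y'"
    using D_F_triangle[of x y x'] D_F_triangle[of x' y y'] assms D_F_commute[of y y'] by linarith
qed

text \<open>
  By the triangle inequality \<open>D_F\<close> does not depend on the representatives of the two classes.
\<close>

lemma D_F_dist_classes:
  assumes "x \<in> topspace full_shift" "y \<in> topspace full_shift"
  shows "D_F_dist F (D_F_rel F `` {x}) (D_F_rel F `` {y}) = D_F F x y"
proof -
  have "(\<lambda>(x, y). D_F F x y) ` (D_F_rel F `` {x} \<times> D_F_rel F `` {y}) = {D_F F x y}"
  proof
    show "(\<lambda>(x, y). D_F F x y) ` (D_F_rel F `` {x} \<times> D_F_rel F `` {y}) \<subseteq> {D_F F x y}"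
      by (auto simp: D_F_rel_def intro!: D_F_cong)
    have "(x, y) \<in> D_F_rel F `` {x} \<times> D_F_rel F `` {y}"
      using assms by (simp add: D_F_rel_def D_F_self)
    then show "{D_F F x y} \<subseteq> (\<lambda>(x, y). D_F F x y) ` (D_F_rel F `` {x} \<times> D_F_rel F `` {y})"
      by (auto intro!: image_eqI[of _ _ "(x, y)"])
  qed
  then show ?thesis
    by (simp add: D_F_dist_def)
qed

lemma count_translate_le:
  "real (card {g \<in> F n. g + t \<in> A})
     \<le> real (card {g \<in> F n. g \<in> A}) + real (card (sym_diff ((\<lambda>h. t + h) ` F n) (F n)))"
proof -
  have "card {g \<in> F n. g + t \<in> A} = card ((\<lambda>h. t + h) ` {g \<in> F n. g + t \<in> A})"
    by (rule card_image[symmetric]) simp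
  also have "\<dots> \<le> card ({g \<in> F n. g \<in> A} \<union> sym_diff ((\<lambda>h. t + h) ` F n) (F n))"
    using folner_finite by (intro card_mono) (auto simp: add.commute)
  also have "\<dots> \<le> card {g \<in> F n. g \<in> A} + card (sym_diff ((\<lambda>h. t + h) ` F n) (F n))"
    by (rule card_Un_le)
  finally show ?thesis
    by linarith
qed

text \<open>
  For fixed \<open>g\<close>, the residues of \<open>g + t\<close> run through all residues modulo \<open>N\<close> once as \<open>t\<close> does, so every
  \<open>g\<close> is counted \<open>card S\<close> times.
\<close>

lemma sum_count_translates:
  fixes N :: int
  assumes N: "0 < N" and S: "S \<subseteq> {0..<N}"
  shows "(\<Sum>t\<in>{0..<N}. card {g \<in> F n. g + t \<in> {h. h mod N \<in> S}}) = card S * card (F n)"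
proof -
  have "(\<Sum>t\<in>{0..<N}. card {g \<in> F n. g + t \<in> {h. h mod N \<in> S}})
      = (\<Sum>t\<in>{0..<N}. \<Sum>g\<in>F n. if (g + t) mod N \<in> S then 1 else 0)"
    using folner_finite by (simp add: sum.If_cases Int_def)
  also have "\<dots> = (\<Sum>g\<in>F n. \<Sum>t\<in>{0..<N}. if (g + t) mod N \<in> S then 1 else 0)"
    by (rule sum.swap)
  also have "\<dots> = (\<Sum>g\<in>F n. card S)"
  proof (rule sum.cong[OF refl])
    fix g
    have "(\<Sum>t\<in>{0..<N}. if (g + t) mod N \<in> S then 1 else 0) = (\<Sum>s\<in>{0..<N}. if s \<in> S then 1 else (0::nat))"
      using N by (intro sum.reindex_bij_witness[where j = "\<lambda>t. (g + t) mod N" and i = "\<lambda>s. (s - g) mod N"])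
        (auto simp: mod_simps)
    also have "\<dots> = card S"
      using S by (simp add: sum.If_cases Int_absorb1)
    finally show "(\<Sum>t\<in>{0..<N}. if (g + t) mod N \<in> S then 1 else 0) = card S" .
  qed
  finally show ?thesis
    by simp
qed

text \<open>
  A union of residue classes has its natural density along every Folner sequence: the counts of its
  \<open>N\<close> translates add up to \<open>card S * card (F n)\<close>, and by the Folner property they differ from each other
  by an amount that is negligible in comparison with \<open>card (F n)\<close>.
\<close>

lemma D_F_ge_residue_density:
  fixes N :: int
  assumes N: "0 < N" and S: "S \<subseteq> {0..<N}"
    and neq: "\<And>g. g mod N \<in> S \<Longrightarrow> x g \<noteq> y g"
  shows "real (card S) / real_of_int N \<le> D_F F x y"
proof -
  define A where "A = {h. h mod N \<in> S}"
  \<comment> \<open>The total error from replacing each of the \<open>N\<close> translates of \<open>A\<close> by \<open>A\<close> itself\<close>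
  define e where "e = (\<lambda>n. \<Sum>t\<in>{0..<N}.
      real (card (sym_diff ((\<lambda>h. t + h) ` F n) (F n))) / real (card (F n)))"
  have e: "e \<longlonglongrightarrow> (\<Sum>t\<in>{0..<N}. 0)"
    unfolding e_def using F by (intro tendsto_sum) (simp add: folner_sequence_def)
  have le: "(real (card S) - e n) / real_of_int N \<le> disagreement x y n" for n
  proof -
    let ?c = "real (card (F n))"
    have "real (card S) * ?c = (\<Sum>t\<in>{0..<N}. real (card {g \<in> F n. g + t \<in> A}))"
      unfolding A_def of_nat_sum[symmetric] of_nat_mult[symmetric]
      by (simp only: sum_count_translates[OF N S])
    also have "\<dots> \<le> (\<Sum>t\<in>{0..<N}. real (card {g \<in> F n. g \<in> A})
        + real (card (sym_diff ((\<lambda>h. t + h) ` F n) (F n))))"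
      by (intro sum_mono count_translate_le)
    also have "\<dots> = real_of_int N * real (card {g \<in> F n. g \<in> A}) + e n * ?c"
      using N folner_card_pos[of n] by (simp add: e_def sum.distrib sum_distrib_right)
    finally have "(real (card S) - e n) * ?c \<le> real_of_int N * real (card {g \<in> F n. g \<in> A})"
      by (simp add: algebra_simps)
    also have "\<dots> \<le> real_of_int N * real (card {g \<in> F n. x g \<noteq> y g})"
      using N neq folner_finite
      by (intro mult_left_mono of_nat_mono card_mono) (auto simp: A_def)
    finally show ?thesis
      using N folner_card_pos[of n] by (simp add: disagreement_def field_simps)
  qed
  have "(\<lambda>n. (real (card S) - e n) / real_of_int N) \<longlonglongrightarrow> (real (card S) - 0) / real_of_int N"
    using e N by (intro tendsto_intros) auto
  then have "limsup (\<lambda>n. ereal ((real (card S) - e n) / real_of_int N)) = ereal (real (card S) / real_of_int N)"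
    by (intro lim_imp_Limsup) simp_all
  moreover have "limsup (\<lambda>n. ereal ((real (card S) - e n) / real_of_int N)) \<le> limsup (\<lambda>n. ereal (disagreement x y n))"
    by (intro Limsup_mono always_eventually) (simp add: le)
  ultimately have "ereal (real (card S) / real_of_int N) \<le> ereal (D_F F x y)"
    by (simp only: ereal_D_F)
  then show ?thesis
    by simp
qed

lemma sep_number_quotient_ge:
  assumes "0 < \<epsilon>" "finite J" "\<And>j. j \<in> J \<Longrightarrow> z j \<in> X" "X \<subseteq> topspace full_shift"
    and sep: "\<And>i j. i \<in> J \<Longrightarrow> j \<in> J \<Longrightarrow> i \<noteq> j \<Longrightarrow> \<epsilon> \<le> D_F F (z i) (z j)"
  shows "enat (card J) \<le> sep_number (D_F_quotient F X) (D_F_dist F) \<epsilon>"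
proof -
  define c where "c = (\<lambda>j. D_F_rel F `` {z j})"
  have dist: "D_F_dist F (c i) (c j) = D_F F (z i) (z j)" if "i \<in> J" "j \<in> J" for i j
    unfolding c_def using that assms by (intro D_F_dist_classes) auto
  have inj: "inj_on c J"
  proof (rule inj_onI, rule ccontr)
    fix i j assume ij: "i \<in> J" "j \<in> J" "c i = c j" "i \<noteq> j"
    then have "D_F F (z i) (z j) = D_F F (z i) (z i)"
      by (simp flip: dist)
    then show False
      using sep[of i j] ij \<open>0 < \<epsilon>\<close> by (simp add: D_F_self)
  qed
  have "c ` J \<subseteq> D_F_quotient F X"
    using assms by (auto simp: c_def D_F_quotient_def)
  moreover have "separated_set (D_F_dist F) \<epsilon> (c ` J)"
    unfolding separated_set_def using sep dist by fastforce
  ultimately have "(if finite (c ` J) then enat (card (c ` J)) else \<infinity>) \<le>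
      sep_number (D_F_quotient F X) (D_F_dist F) \<epsilon>"
    unfolding sep_number_def by (intro SUP_upper) simp
  then show ?thesis
    using assms(2) inj by (simp add: card_image)
qed

end

section \<open>Box dimension\<close>

lemma log_enat_ge:
  assumes "enat k \<le> N" "0 < k"
  shows "ereal (ln (real k)) \<le> log_enat N"
  using assms by (cases N) (auto simp: log_enat_def)

lemma upper_box_dim_singleton: "upper_box_dim {p} d = 0"
proof -
  have "sep_number {p} d \<epsilon> = enat 1" for \<epsilon>
    unfolding sep_number_def
  proof (rule antisym)
    show "(SUP A\<in>{A. A \<subseteq> {p} \<and> separated_set d \<epsilon> A}. if finite A then enat (card A) else \<infinity>) \<le> enat 1"
    proof (rule SUP_least)
      fix A assume "A \<in> {A. A \<subseteq> {p} \<and> separated_set d \<epsilon> A}"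
      then have "A = {} \<or> A = {p}"
        by auto
      then show "(if finite A then enat (card A) else \<infinity>) \<le> enat 1"
        by auto
    qed
    have "(if finite {p} then enat (card {p}) else \<infinity>) \<le>
        (SUP A\<in>{A. A \<subseteq> {p} \<and> separated_set d \<epsilon> A}. if finite A then enat (card A) else \<infinity>)"
      by (rule SUP_upper) (simp add: separated_set_def)
    then show "enat 1 \<le> (SUP A\<in>{A. A \<subseteq> {p} \<and> separated_set d \<epsilon> A}. if finite A then enat (card A) else \<infinity>)"
      by simp
  qed
  then have "log_enat (sep_number {p} d \<epsilon>) = 0" for \<epsilon>
    by (simp add: log_enat_def)
  then show ?thesis
    by (simp add: upper_box_dim_def Limsup_const)
qed

text \<open>
  An upper limit is bounded below by its values along a sequence of scales that tends to \<open>0\<close>.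
\<close>

lemma upper_box_dim_eq_infinity:
  assumes N: "\<And>n. enat (N n) \<le> sep_number Z d (\<epsilon> n)" "\<And>n. 0 < N n"
    and \<epsilon>: "\<And>n. 0 < \<epsilon> n" "\<And>n. \<epsilon> n < 1" "\<epsilon> \<longlonglongrightarrow> 0"
    and ratio: "filterlim (\<lambda>n. ln (real (N n)) / - ln (\<epsilon> n)) at_top sequentially"
  shows "upper_box_dim Z d = \<infinity>"
proof -
  let ?f = "\<lambda>e. log_enat (sep_number Z d e) / ereal (- ln e)"
  have ge: "ereal (ln (real (N n)) / - ln (\<epsilon> n)) \<le> ?f (\<epsilon> n)" for n
  proof -
    have "0 < - ln (\<epsilon> n)"
      using \<epsilon>(1,2)[of n] by simp
    then have "ereal (ln (real (N n))) / ereal (- ln (\<epsilon> n)) \<le> ?f (\<epsilon> n)"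
      using N[of n] by (intro ereal_divide_right_mono log_enat_ge) auto
    with \<open>0 < - ln (\<epsilon> n)\<close> show ?thesis
      by simp
  qed
  have \<epsilon>_right: "filterlim \<epsilon> (at_right 0) sequentially"
    unfolding filterlim_at using \<epsilon> by (auto intro!: always_eventually simp: less_imp_neq[symmetric])
  have "ereal r \<le> Limsup (at_right 0) ?f" for r
    unfolding Limsup_def
  proof (rule INF_greatest)
    fix P :: "real \<Rightarrow> bool" assume "P \<in> {P. eventually P (at_right 0)}"
    then have "eventually (\<lambda>n. P (\<epsilon> n)) sequentially"
      using \<epsilon>_right by (simp add: filterlim_iff)
    moreover have "eventually (\<lambda>n. r \<le> ln (real (N n)) / - ln (\<epsilon> n)) sequentially"
      using ratio by (simp add: filterlim_at_top)
    ultimately have "eventually (\<lambda>n. P (\<epsilon> n) \<and> r \<le> ln (real (N n)) / - ln (\<epsilon> n)) sequentially"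
      by (rule eventually_conj)
    then obtain n where n: "P (\<epsilon> n)" "r \<le> ln (real (N n)) / - ln (\<epsilon> n)"
      using eventually_happens' sequentially_bot by blast
    have "ereal r \<le> ?f (\<epsilon> n)"
      using n(2) ge[of n] order_trans ereal_less_eq(3) by blast
    also have "\<dots> \<le> Sup (?f ` Collect P)"
      using n(1) by (intro SUP_upper) simp
    finally show "ereal r \<le> Sup (?f ` Collect P)" .
  qed
  then show ?thesis
    unfolding upper_box_dim_def by (rule ereal_top)
qed

section \<open>The window\<close>

context odometer_radix
begin

lemma in_closure_odo_iff:
  assumes "x \<in> carrier H"
  shows "x \<in> T closure_of S \<longleftrightarrow> (\<forall>n. \<exists>y\<in>S. y \<in> carrier H \<and> val n y = val n x)"
proof
  assume x: "x \<in> T closure_of S"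
  show "\<forall>n. \<exists>y\<in>S. y \<in> carrier H \<and> val n y = val n x"
  proof
    fix n
    have "x \<in> cyl n (val n x)"
      using assms by (simp add: cyl_def)
    then obtain y where "y \<in> S" "y \<in> cyl n (val n x)"
      using x openin_cyl[of n "val n x"] by (auto simp: in_closure_of)
    then show "\<exists>y\<in>S. y \<in> carrier H \<and> val n y = val n x"
      by (auto simp: cyl_def)
  qed
next
  assume S: "\<forall>n. \<exists>y\<in>S. y \<in> carrier H \<and> val n y = val n x"
  show "x \<in> T closure_of S"
    unfolding in_closure_of topspace_odo
  proof (intro conjI allI impI)
    fix U assume U: "x \<in> U \<and> openin T U"
    then obtain n where n: "cyl n (val n x) \<subseteq> U"
      by (auto simp: openin_odo_iff)
    obtain y where "y \<in> S" "y \<in> carrier H" "val n y = val n x"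
      using S by blast
    with n show "\<exists>y. y \<in> S \<and> y \<in> U"
      by (auto simp: cyl_def)
  qed (rule assms)
qed

lemma in_interior_odo_iff:
  assumes "x \<in> carrier H"
  shows "x \<in> T interior_of S \<longleftrightarrow> (\<exists>n. cyl n (val n x) \<subseteq> S)"
proof
  assume "x \<in> T interior_of S"
  then show "\<exists>n. cyl n (val n x) \<subseteq> S"
    by (auto simp: interior_of_def openin_odo_iff) blast
next
  assume "\<exists>n. cyl n (val n x) \<subseteq> S"
  then obtain n where "cyl n (val n x) \<subseteq> S" ..
  moreover have "x \<in> cyl n (val n x)"
    using assms by (simp add: cyl_def)
  ultimately show "x \<in> T interior_of S"
    using openin_cyl by (auto simp: interior_of_def)
qed

end

text \<open>
  The exponential growth has two purposes: a digit at place \<open>n + 1\<close> is a string of \<open>q n - 1\<close> bits,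
  which can be indexed by the digits other than \<open>1\<close> at place \<open>n\<close>; and \<open>q (n + 1)\<close> exceeds every fixed
  power of \<open>q 0 * \<dots> * q n\<close> eventually.
\<close>

locale exponential_radix =
  fixes q :: "nat \<Rightarrow> nat"
  assumes radix_0: "q 0 = 3"
    and radix_Suc: "q (Suc n) = 2 ^ (q n - 1)"
begin

lemma radix_ge_3: "3 \<le> q n"
proof (induction n)
  case (Suc n)
  have "(3::nat) \<le> 2 ^ 2"
    by simp
  also have "(2::nat) ^ 2 \<le> 2 ^ (q n - 1)"
    using Suc by (intro power_increasing) auto
  finally show ?case
    by (simp add: radix_Suc)
qed (simp add: radix_0)

sublocale odometer_radix q
proof
  show "2 \<le> q n" for n
    using radix_ge_3[of n] by linarith
qed

text \<open>
  The boundary point of the window. Its digits are neither eventually \<open>0\<close> nor eventually maximal,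
  which keeps it out of the image of the integers.
\<close>

definition ones :: "nat \<Rightarrow> nat" where
  "ones = (\<lambda>_. 1)"

text \<open>
  If \<open>n\<close> is the first place at which \<open>x\<close> differs from \<open>ones\<close>, then \<open>x n\<close> selects a bit of the next digit,
  and this bit decides. Truncated subtraction makes \<open>d - 1\<close> a bijection from the digits \<open>d \<noteq> 1\<close> below
  \<open>q n\<close> onto the bit positions below \<open>q n - 1\<close>. The point \<open>ones\<close> belongs to the window vacuously.
\<close>

definition window :: "(nat \<Rightarrow> nat) set" where
  "window = {x \<in> carrier H. \<forall>n. (\<forall>i<n. x i = 1) \<longrightarrow> x n \<noteq> 1 \<longrightarrow> bit (x (Suc n)) (x n - 1)}"

text \<open>
  Points that agree with \<open>ones\<close> below place \<open>n\<close> and lie inside the window for \<open>b = 1\<close>, outside for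
  \<open>b = 0\<close>.
\<close>

definition probe :: "nat \<Rightarrow> nat \<Rightarrow> nat \<Rightarrow> nat" where
  "probe n b = (\<lambda>i. if i < n then 1 else if i = Suc n then b else 0)"

lemma ones_in_carrier: "ones \<in> carrier H"
  unfolding carrier_iff ones_def
proof
  show "1 < q n" for n
    using radix_ge_3[of n] by linarith
qed

lemma window_subset: "window \<subseteq> carrier H"
  by (auto simp: window_def)

lemma ones_in_window: "ones \<in> window"
  using ones_in_carrier by (simp add: window_def ones_def)

lemma in_window_iff:
  assumes "x \<in> carrier H" "\<And>i. i < n \<Longrightarrow> x i = 1" "x n \<noteq> 1"
  shows "x \<in> window \<longleftrightarrow> bit (x (Suc n)) (x n - 1)"
proof -
  have "m = n" if "\<forall>i<m. x i = 1" "x m \<noteq> 1" for m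
    using that assms(2,3) by (metis linorder_neqE_nat)
  then show ?thesis
    using assms unfolding window_def by blast
qed

lemma probe_in_carrier: "b < 2 \<Longrightarrow> probe n b \<in> carrier H"
  unfolding carrier_iff
proof
  show "probe n b i < q i" if "b < 2" for i
    using radix_ge_3[of i] that by (auto simp: probe_def)
qed

lemma val_probe: "val n (probe n b) = val n ones"
  by (rule odo_val_cong) (simp add: probe_def ones_def)

lemma probe_in_window_iff: "b < 2 \<Longrightarrow> probe n b \<in> window \<longleftrightarrow> b = 1"
  using in_window_iff[OF probe_in_carrier[of b n], of n]
  by (auto simp: probe_def bit_0 less_2_cases_iff)

lemma probe_neq_ones: "probe n b \<noteq> ones"
  by (auto simp: probe_def ones_def fun_eq_iff intro!: exI[of _ n])

text \<open>
  Away from \<open>ones\<close>, the first place \<open>n\<close> that differs from \<open>1\<close> is visible, and the digits at places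
  \<open>n\<close> and \<open>n + 1\<close> then decide membership; so level \<open>n + 2\<close> suffices. Hence \<open>ones\<close> is the only
  candidate for a boundary point.
\<close>

lemma window_locally_constant:
  assumes x: "x \<in> carrier H" "x \<noteq> ones"
  obtains n where "\<And>y. y \<in> cyl n (val n x) \<Longrightarrow> y \<in> window \<longleftrightarrow> x \<in> window"
proof -
  have "\<exists>n. x n \<noteq> 1"
    using x by (auto simp: ones_def)
  define n where "n = (LEAST n. x n \<noteq> 1)"
  have n: "x n \<noteq> 1"
    unfolding n_def by (rule LeastI_ex) fact
  have below: "x i = 1" if "i < n" for i
    using not_less_Least[of i "\<lambda>n. x n \<noteq> 1"] that by (auto simp: n_def)
  show ?thesis
  proof
    fix y assume "y \<in> cyl (n + 2) (val (n + 2) x)"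
    then have y: "y \<in> carrier H" and eq: "\<And>i. i < n + 2 \<Longrightarrow> y i = x i"
      using val_eq_iff[OF _ x(1)] by (auto simp: cyl_def)
    show "y \<in> window \<longleftrightarrow> x \<in> window"
      using in_window_iff[OF x(1) below n] in_window_iff[OF y, of n] below n eq by simp
  qed
qed

lemma closedin_window: "closedin T window"
  unfolding closedin_def topspace_odo openin_odo_iff
proof (intro conjI ballI)
  fix x assume x: "x \<in> carrier H - window"
  then obtain n where n: "\<And>y. y \<in> cyl n (val n x) \<Longrightarrow> y \<in> window \<longleftrightarrow> x \<in> window"
    using window_locally_constant[of x] ones_in_window by blast
  have "cyl n (val n x) \<subseteq> carrier H - window"
    using n x by (auto simp: cyl_def)
  then show "\<exists>n. cyl n (val n x) \<subseteq> carrier H - window" ..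
qed (use window_subset in auto)

lemma interior_window: "T interior_of window = window - {ones}"
proof (intro subset_antisym subsetI)
  fix x assume x: "x \<in> T interior_of window"
  then have xW: "x \<in> window"
    by (rule subsetD[OF interior_of_subset])
  moreover have "x \<noteq> ones"
  proof
    assume "x = ones"
    then obtain n where n: "cyl n (val n ones) \<subseteq> window"
      using x in_interior_odo_iff[OF ones_in_carrier] by auto
    have "probe n 0 \<in> cyl n (val n ones)"
      by (simp add: cyl_def probe_in_carrier val_probe)
    with n show False
      using probe_in_window_iff[of 0 n] by auto
  qed
  ultimately show "x \<in> window - {ones}"
    by simp
next
  fix x assume x: "x \<in> window - {ones}"
  then obtain n where n: "\<And>y. y \<in> cyl n (val n x) \<Longrightarrow> y \<in> window \<longleftrightarrow> x \<in> window"
    using window_locally_constant[of x] window_subset by blast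
  then have "cyl n (val n x) \<subseteq> window"
    using x by blast
  then show "x \<in> T interior_of window"
    using x window_subset by (subst in_interior_odo_iff) auto
qed

lemma frontier_window: "T frontier_of window = {ones}"
  unfolding frontier_of_def interior_window closure_of_closedin[OF closedin_window]
  using ones_in_window by auto

text \<open>
  Far out, the digits of the image of an integer are all \<open>0\<close> (if it is nonnegative) or all
  maximal (if it is negative), and a maximal digit is at least \<open>2\<close>.
\<close>

lemma ones_not_tau: "ones \<notin> range (odo_tau q)"
proof
  assume "ones \<in> range (odo_tau q)"
  then obtain k where k: "odo_tau q k = ones"
    by (metis rangeE)
  define n where "n = nat \<bar>k\<bar>"
  have "\<bar>k\<bar> < 2 ^ n"
    unfolding n_def using of_nat_less_two_power[of "nat \<bar>k\<bar>", where 'a = int] by simp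
  then have small: "\<bar>k\<bar> < Q n"
    using Q_ge_power[of n] by linarith
  have 3: "3 \<le> int (q n)"
    using radix_ge_3[of n] by simp
  have "k div Q n mod int (q n) = 1"
    using odo_tau_digit[of k n] by (simp add: k ones_def)
  \<comment> \<open>For negative \<open>k\<close> the quotient is \<open>-1\<close>, with remainder \<open>k + Q n\<close>.\<close>
  moreover have "k div Q n = (if k < 0 then - 1 else 0)"
    using small by (auto simp: div_pos_neg_trivial div_pos_pos_trivial abs_if split: if_splits
        intro!: int_div_pos_eq[where r = "k + Q n"])
  moreover have "(- 1) mod int (q n) = int (q n) - 1"
    using 3 by (intro int_mod_pos_eq[where q = "- 1"]) auto
  ultimately show False
    using 3 by (auto split: if_splits)
qed

text \<open>
  A translation that preserves the window must fix its only boundary point, hence is trivial. The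
  probes near \<open>ones\<close> are translated to points near \<open>ones + \<xi>\<close> on both sides of the window.
\<close>

lemma window_irredundant:
  assumes \<xi>: "\<xi> \<in> carrier H" and eq: "window #>\<^bsub>H\<^esub> \<xi> = window"
  shows "\<xi> = \<one>\<^bsub>H\<^esub>"
proof -
  have shift: "x \<otimes>\<^bsub>H\<^esub> \<xi> \<in> window \<longleftrightarrow> x \<in> window" if x: "x \<in> carrier H" for x
  proof -
    have "x \<otimes>\<^bsub>H\<^esub> \<xi> \<in> window #>\<^bsub>H\<^esub> \<xi> \<longleftrightarrow> x \<in> window"
      unfolding r_coset_eq_vimage[OF window_subset \<xi>] using x \<xi> by (simp add: m_assoc)
    then show ?thesis
      by (simp add: eq)
  qed
  have "ones \<otimes>\<^bsub>H\<^esub> \<xi> = ones"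
  proof (rule ccontr)
    assume ne: "ones \<otimes>\<^bsub>H\<^esub> \<xi> \<noteq> ones"
    obtain n where n: "\<And>y. y \<in> cyl n (val n (ones \<otimes>\<^bsub>H\<^esub> \<xi>)) \<Longrightarrow>
        y \<in> window \<longleftrightarrow> ones \<otimes>\<^bsub>H\<^esub> \<xi> \<in> window"
      using window_locally_constant[OF mult_closed ne] by blast
    have "probe n b \<otimes>\<^bsub>H\<^esub> \<xi> \<in> cyl n (val n (ones \<otimes>\<^bsub>H\<^esub> \<xi>))" for b
      by (simp add: cyl_def mult_closed val_probe)
    then have "probe n 0 \<otimes>\<^bsub>H\<^esub> \<xi> \<in> window \<longleftrightarrow> probe n 1 \<otimes>\<^bsub>H\<^esub> \<xi> \<in> window"
      using n by blast
    then show False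
      by (simp add: shift probe_in_carrier probe_in_window_iff)
  qed
  then show ?thesis
    using l_cancel_one[OF ones_in_carrier \<xi>] by simp
qed

lemma window_in_W_reg: "window \<in> W_reg q"
  unfolding W_reg_def
proof (intro CollectI conjI)
  have "openin T (carrier H - window)"
    using closedin_window by (simp add: closedin_def)
  then have "carrier H - window \<in> sets (borel_algebra T)"
    unfolding borel_algebra_def topspace_odo
    by (subst sets_measure_of) (auto simp: openin_odo_iff)
  then have "carrier H - (carrier H - window) \<in> sets (borel_algebra T)"
    using sets.compl_sets space_borel[OF refl] by metis
  then show "window \<in> sets (borel_algebra T)"
    using window_subset by (simp add: double_diff)
  show "generic_window q window"
    using ones_not_tau by (simp add: generic_window_def frontier_window)
  show "irredundant_window q window"
    unfolding irredundant_window_def using window_irredundant by blast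
  show "regular_window q window"
    by (simp add: regular_window_def frontier_window haar_singleton ones_in_carrier)
  \<comment> \<open>The probes inside the window accumulate at \<open>ones\<close>.\<close>
  have "window \<subseteq> T closure_of (window - {ones})"
  proof
    fix x assume x: "x \<in> window"
    show "x \<in> T closure_of (window - {ones})"
    proof (cases "x = ones")
      case True
      have "\<exists>y\<in>window - {ones}. y \<in> carrier H \<and> val n y = val n ones" for n
        by (rule bexI[of _ "probe n 1"])
           (simp_all add: probe_in_carrier val_probe probe_in_window_iff probe_neq_ones)
      then show ?thesis
        unfolding True in_closure_odo_iff[OF ones_in_carrier] ..
    next
      case False
      have "window - {ones} \<subseteq> T closure_of (window - {ones})"
        using window_subset by (intro closure_of_subset) auto
      with x False show ?thesis
        by blast
    qed
  qed
  moreover have "T closure_of (window - {ones}) \<subseteq> window"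
    by (rule closure_of_minimal[OF _ closedin_window]) auto
  ultimately show "proper_window q window"
    unfolding proper_window_def interior_window
    using closedin_compact_space[OF compact_odo closedin_window] by (intro conjI subset_antisym)
qed

end

section \<open>Translates of the window\<close>

lemma ex_bit_differs:
  fixes u v :: nat
  assumes "u < 2 ^ k" "v < 2 ^ k" "u \<noteq> v"
  shows "\<exists>i<k. bit u i \<noteq> bit v i"
proof (rule ccontr)
  assume "\<not> (\<exists>i<k. bit u i \<noteq> bit v i)"
  then have "take_bit k u = take_bit k v"
    by (intro bit_eqI) (auto simp: bit_take_bit_iff)
  then show False
    using assms by (simp add: take_bit_nat_eq_self)
qed

context exponential_radix
begin

text \<open>
  The translates by multiples of \<open>Q (Suc n)\<close>. They leave the digits up to place \<open>n\<close> alone and rotate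
  the digit at place \<open>n + 1\<close>.
\<close>

abbreviation translate :: "nat \<Rightarrow> nat \<Rightarrow> int \<Rightarrow> nat" where
  "translate n j \<equiv> (\<lambda>k. window_sequence q window (k + int j * Q (Suc n)))"

lemma window_sequence_eq_iff:
  "window_sequence q window k = window_sequence q window l \<longleftrightarrow>
     (odo_tau q k \<in> window \<longleftrightarrow> odo_tau q l \<in> window)"
  by (simp add: window_sequence_def indicator_def)

lemma tau_translate_digits:
  shows "i \<le> n \<Longrightarrow> odo_tau q (g + int j * Q (Suc n)) i = odo_tau q g i"
    and "odo_tau q (g + int j * Q (Suc n)) (Suc n) = (odo_tau q g (Suc n) + j) mod q (Suc n)"
proof -
  have "val (Suc n) (odo_tau q (g + int j * Q (Suc n))) = val (Suc n) (odo_tau q g)"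
    by (simp add: val_tau)
  then show "odo_tau q (g + int j * Q (Suc n)) i = odo_tau q g i" if "i \<le> n"
    using that val_eq_iff[OF odo_tau_in_carrier odo_tau_in_carrier] by (simp add: less_Suc_eq_le)
  have "int (odo_tau q (g + int j * Q (Suc n)) (Suc n)) = (g div Q (Suc n) + int j) mod int (q (Suc n))"
    by (simp only: odo_tau_digit div_mult_self1[OF Q_nonzero] add.commute)
  also have "\<dots> = (int (odo_tau q g (Suc n)) + int j) mod int (q (Suc n))"
    by (simp only: odo_tau_digit mod_add_left_eq)
  finally show "odo_tau q (g + int j * Q (Suc n)) (Suc n) = (odo_tau q g (Suc n) + j) mod q (Suc n)"
    by (metis of_nat_add of_nat_eq_iff of_nat_mod)
qed

text \<open>
  Different rotations of the digit \<open>m\<close> at place \<open>n + 1\<close> give different strings of \<open>q n - 1\<close> bits; a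
  position at which they differ is selected by some digit \<open>d\<close> at place \<open>n\<close>.
\<close>

lemma ex_separating_digit:
  assumes "j < q (Suc n)" "j' < q (Suc n)" "j \<noteq> j'"
  shows "\<exists>d<q n. d \<noteq> 1 \<and>
    bit ((m + j) mod q (Suc n)) (d - 1) \<noteq> bit ((m + j') mod q (Suc n)) (d - 1)"
proof -
  have "(m + j) mod q (Suc n) \<noteq> (m + j') mod q (Suc n)"
  proof
    assume "(m + j) mod q (Suc n) = (m + j') mod q (Suc n)"
    then have "[m + j = m + j'] (mod q (Suc n))"
      by (simp only: cong_def)
    then have "[j = j'] (mod q (Suc n))"
      by (simp only: cong_add_lcancel_nat)
    then show False
      using assms by (simp add: cong_def)
  qed
  moreover have "u mod q (Suc n) < 2 ^ (q n - 1)" for u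
    using radix_pos[of "Suc n"] unfolding radix_Suc by (rule mod_less_divisor)
  ultimately obtain i where i: "i < q n - 1"
      "bit ((m + j) mod q (Suc n)) i \<noteq> bit ((m + j') mod q (Suc n)) i"
    using ex_bit_differs by blast
  \<comment> \<open>The digit other than \<open>1\<close> that selects bit \<open>i\<close>\<close>
  show ?thesis
  proof (intro exI[of _ "if i = 0 then 0 else Suc i"] conjI)
    show "(if i = 0 then 0 else Suc i) < q n"
      using i(1) by auto
  qed (use i(2) in auto)
qed

text \<open>
  For every digit \<open>m\<close> at place \<open>n + 1\<close> there is a digit \<open>d m\<close> at place \<open>n\<close> such that the two translates
  differ on the cylinder of level \<open>n + 2\<close> with digits \<open>1, \<dots>, 1, d m, m\<close>. These are \<open>q (n + 1)\<close> residue
  classes modulo \<open>Q (n + 2) = Q (n + 1) * q (n + 1)\<close>, of total density \<open>1 / Q (n + 1)\<close>.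
\<close>

lemma D_F_translates_ge:
  assumes F: "folner_sequence F" and j: "j < q (Suc n)" "j' < q (Suc n)" "j \<noteq> j'"
  shows "1 / real_of_int (Q (Suc n)) \<le> D_F F (translate n j) (translate n j')"
proof -
  obtain d where d: "\<And>m. d m < q n" "\<And>m. d m \<noteq> 1"
      "\<And>m. bit ((m + j) mod q (Suc n)) (d m - 1) \<noteq> bit ((m + j') mod q (Suc n)) (d m - 1)"
    using ex_separating_digit[OF j] by metis
  \<comment> \<open>The cylinder that belongs to \<open>m\<close> is the one of level \<open>n + 2\<close> around \<open>w m\<close>.\<close>
  define w where "w = (\<lambda>m i. if i < n then 1 else if i = n then d m else if i = Suc n then m else 0)"
  have w: "w m \<in> carrier H" if "m < q (Suc n)" for m
    unfolding carrier_iff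
  proof
    show "w m i < q i" for i
      using radix_ge_3[of i] that d(1)[of m] by (auto simp: w_def)
  qed
  let ?S = "(\<lambda>m. val (Suc (Suc n)) (w m)) ` {..<q (Suc n)}"
  have inj: "inj_on (\<lambda>m. val (Suc (Suc n)) (w m)) {..<q (Suc n)}"
  proof (rule inj_onI)
    fix m m' assume mm: "m \<in> {..<q (Suc n)}" "m' \<in> {..<q (Suc n)}"
      and "val (Suc (Suc n)) (w m) = val (Suc (Suc n)) (w m')"
    then have "w m (Suc n) = w m' (Suc n)"
      using val_eq_iff[OF w w] by (metis lessI lessThan_iff)
    then show "m = m'"
      by (simp add: w_def)
  qed
  have "real (card ?S) / real_of_int (Q (Suc (Suc n))) \<le> D_F F (translate n j) (translate n j')"
  proof (rule D_F_ge_residue_density[OF F Q_pos])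
    show "?S \<subseteq> {0..<Q (Suc (Suc n))}"
      using val_nonneg val_less[OF w] by auto
    fix g assume "g mod Q (Suc (Suc n)) \<in> ?S"
    then obtain m where m: "m < q (Suc n)" "g mod Q (Suc (Suc n)) = val (Suc (Suc n)) (w m)"
      by auto
    then have "val (Suc (Suc n)) (odo_tau q g) = val (Suc (Suc n)) (w m)"
      by (simp only: val_tau)
    then have tau: "odo_tau q g i = w m i" if "i \<le> Suc n" for i
      using val_eq_iff[OF odo_tau_in_carrier w[OF m(1)]] that by (simp add: less_Suc_eq_le)
    have mem: "odo_tau q (g + int l * Q (Suc n)) \<in> window \<longleftrightarrow> bit ((m + l) mod q (Suc n)) (d m - 1)" for l
    proof -
      have digits: "odo_tau q (g + int l * Q (Suc n)) i = w m i" if "i \<le> n" for i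
        using that by (simp add: tau_translate_digits tau)
      have "odo_tau q (g + int l * Q (Suc n)) (Suc n) = (m + l) mod q (Suc n)"
        by (simp add: tau_translate_digits tau w_def)
      then show ?thesis
        using in_window_iff[OF odo_tau_in_carrier, of n "g + int l * Q (Suc n)"] digits d(2)[of m]
        by (simp add: w_def)
    qed
    show "translate n j g \<noteq> translate n j' g"
      by (simp only: window_sequence_eq_iff mem d(3) simp_thms)
  qed
  moreover have "real (card ?S) / real_of_int (Q (Suc (Suc n))) = 1 / real_of_int (Q (Suc n))"
    using inj by (simp add: card_image odo_period_Suc[of q "Suc n"])
  ultimately show ?thesis
    by simp
qed

lemma translate_in_orbit_closure:
  "translate n j \<in> orbit_closure (window_sequence q window)"
  "orbit_closure (window_sequence q window) \<subseteq> topspace full_shift"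
proof -
  have "range (\<lambda>l k. window_sequence q window (k + l)) \<subseteq> topspace full_shift"
    by (auto simp: full_shift_def window_sequence_def indicator_def)
  then have "range (\<lambda>l k. window_sequence q window (k + l)) \<subseteq> orbit_closure (window_sequence q window)"
    unfolding orbit_closure_def by (rule closure_of_subset)
  then show "translate n j \<in> orbit_closure (window_sequence q window)"
    by blast
  show "orbit_closure (window_sequence q window) \<subseteq> topspace full_shift"
    unfolding orbit_closure_def by (rule closure_of_subset_topspace)
qed

lemma radix_ge: "n + 3 \<le> q n"
proof (induction n)
  case (Suc n)
  have "Suc n + 3 \<le> 2 ^ (n + 2)"
    by (induction n) auto
  also have "(2::nat) ^ (n + 2) \<le> 2 ^ (q n - 1)"
    using Suc by (intro power_increasing) auto
  finally show ?case
    by (simp add: radix_Suc)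
qed (simp add: radix_0)

text \<open>
  The step that makes the square bound in \<open>Q_le_radix_square\<close> pass to the next radix.
\<close>

lemma cube_le_power_4: "4 \<le> k \<Longrightarrow> k ^ 3 \<le> (4::nat) ^ (k - 1)"
proof (induction k rule: dec_induct)
  case (step k)
  have "Suc k ^ 3 \<le> 4 * k ^ 3"
  proof -
    obtain a where "k = 4 + a"
      using step.hyps(1) by (rule le_Suc_ex[THEN exE])
    then show ?thesis
      by (simp add: power3_eq_cube algebra_simps)
  qed
  also have "\<dots> \<le> 4 * 4 ^ (k - 1)"
    using step.IH by simp
  also have "\<dots> = 4 ^ (Suc k - 1)"
    using step.hyps by (simp flip: power_Suc)
  finally show ?case .
qed simp

text \<open>
  The next radix \<open>q (n + 1) = 2 ^ (q n - 1)\<close> dominates the product of all earlier ones: inductively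
  \<open>Q (n + 1) \<le> (q n) ^ 3 \<le> 4 ^ (q n - 1) = (q (n + 1)) ^ 2\<close>. The middle inequality needs \<open>q n \<ge> 4\<close>,
  so the step from \<open>0\<close> to \<open>1\<close> is done by computation.
\<close>

lemma Q_le_radix_square: "Q n \<le> int (q n) ^ 2"
proof (induction n)
  case 0
  show ?case
    by (simp add: radix_0)
next
  case (Suc n)
  show ?case
  proof (cases n)
    case 0
    then show ?thesis
      by (simp add: odo_period_Suc radix_Suc radix_0)
  next
    case (Suc m)
    have "4 \<le> q n"
      using radix_ge[of n] Suc by simp
    have "Q (Suc n) \<le> int (q n) ^ 2 * int (q n)"
      using Suc.IH by (simp add: odo_period_Suc mult_right_mono)
    also have "\<dots> = int (q n ^ 3)"
      by (simp add: power3_eq_cube power2_eq_square)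
    also have "\<dots> \<le> int (4 ^ (q n - 1))"
      using cube_le_power_4[OF \<open>4 \<le> q n\<close>] by (rule of_nat_mono)
    also have "\<dots> = int (q (Suc n)) ^ 2"
      by (simp add: radix_Suc flip: power_mult_distrib power_mult) (simp add: power_mult mult.commute)
    finally show ?thesis .
  qed
qed

text \<open>
  The numerator is \<open>(q n - 1) * ln 2\<close>, while the denominator is at most \<open>3 * ln (q n)\<close>.
\<close>

lemma growth: "filterlim (\<lambda>n. ln (real (q (Suc n))) / ln (real_of_int (Q (Suc n)))) at_top sequentially"
proof (rule filterlim_at_top_mono)
  have "filterlim (\<lambda>n. real (q n)) at_top sequentially"
  proof (rule filterlim_at_top_mono[OF filterlim_real_sequentially])
    show "\<forall>\<^sub>F n in sequentially. real n \<le> real (q n)"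
      using radix_ge by (intro always_eventually allI of_nat_mono) (meson add_leD1)
  qed
  moreover have "filterlim (\<lambda>x::real. (x - 1) * ln 2 / (3 * ln x)) at_top at_top"
    by real_asymp
  ultimately show "filterlim (\<lambda>n. (real (q n) - 1) * ln 2 / (3 * ln (real (q n)))) at_top sequentially"
    by (rule filterlim_compose[rotated])
  have "(real (q n) - 1) * ln 2 / (3 * ln (real (q n))) \<le> ln (real (q (Suc n))) / ln (real_of_int (Q (Suc n)))" for n
  proof -
    have q3: "3 \<le> q n"
      by (rule radix_ge_3)
    have "2 \<le> Q (Suc n)"
      using Q_ge_power[of "Suc n", unfolded power_Suc] one_le_power[of "2::int" n] by linarith
    then have pos: "0 < ln (real_of_int (Q (Suc n)))"
      by simp
    have "Q (Suc n) \<le> int (q n) ^ 2 * int (q n)"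
      using Q_le_radix_square[of n] by (simp add: odo_period_Suc mult_right_mono)
    then have "real_of_int (Q (Suc n)) \<le> real_of_int (int (q n) ^ 2 * int (q n))"
      by (simp only: of_int_le_iff)
    then have "real_of_int (Q (Suc n)) \<le> real (q n) ^ 3"
      by (simp add: power2_eq_square power3_eq_cube)
    then have "ln (real_of_int (Q (Suc n))) \<le> ln (real (q n) ^ 3)"
      by (intro ln_mono) simp_all
    also have "\<dots> = 3 * ln (real (q n))"
      using q3 by (simp add: ln_realpow)
    finally have le: "ln (real_of_int (Q (Suc n))) \<le> 3 * ln (real (q n))" .
    have "ln (real (q (Suc n))) = (real (q n) - 1) * ln 2"
      using q3 by (simp add: radix_Suc ln_realpow of_nat_diff)
    moreover have "0 \<le> (real (q n) - 1) * ln 2"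
      using q3 by simp
    ultimately show ?thesis
      using frac_le[OF _ order_refl pos le] by simp
  qed
  then show "\<forall>\<^sub>F n in sequentially. (real (q n) - 1) * ln 2 / (3 * ln (real (q n)))
      \<le> ln (real (q (Suc n))) / ln (real_of_int (Q (Suc n)))"
    by simp
qed

text \<open>
  At scale \<open>1 / Q (n + 1)\<close> the \<open>q (n + 1)\<close> translates \<open>translate n j\<close> are separated, and the logarithm of
  their number outgrows that of the scale.
\<close>

lemma upper_amorphic_complexity_window:
  assumes F: "folner_sequence F"
  shows "upper_amorphic_complexity F (orbit_closure (window_sequence q window)) = \<infinity>"
  unfolding upper_amorphic_complexity_def
proof (rule upper_box_dim_eq_infinity)
  let ?\<epsilon> = "\<lambda>n. 1 / real_of_int (Q (Suc n))"
  have Q2: "2 ^ Suc n \<le> real_of_int (Q (Suc n))" for n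
    using Q_ge_power[of "Suc n"] by (metis of_int_le_iff of_int_numeral of_int_power)
  show "enat (q (Suc n)) \<le> sep_number (D_F_quotient F (orbit_closure (window_sequence q window))) (D_F_dist F) (?\<epsilon> n)" for n
  proof -
    have "enat (card {..<q (Suc n)}) \<le> sep_number (D_F_quotient F (orbit_closure (window_sequence q window))) (D_F_dist F) (?\<epsilon> n)"
    proof (rule sep_number_quotient_ge[OF F, where z = "translate n"])
      show "?\<epsilon> n \<le> D_F F (translate n i) (translate n j)"
        if "i \<in> {..<q (Suc n)}" "j \<in> {..<q (Suc n)}" "i \<noteq> j" for i j
        using that by (intro D_F_translates_ge[OF F]) auto
    qed (simp_all add: translate_in_orbit_closure)
    then show ?thesis
      by simp
  qed
  show "0 < ?\<epsilon> n" for n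
    by simp
  show "?\<epsilon> n < 1" for n
  proof -
    have "1 < (2::real) ^ Suc n"
      by (rule one_less_power) simp_all
    then show ?thesis
      using Q2[of n] by simp
  qed
  show "?\<epsilon> \<longlonglongrightarrow> 0"
  proof (rule tendsto_sandwich[OF _ _ tendsto_const])
    show "(\<lambda>n. (1/2) ^ Suc n :: real) \<longlonglongrightarrow> 0"
      by (intro LIMSEQ_Suc LIMSEQ_power_zero) simp
    have "?\<epsilon> n \<le> (1/2) ^ Suc n" for n
      unfolding power_one_over by (rule divide_left_mono[OF Q2]) simp_all
    then show "\<forall>\<^sub>F n in sequentially. ?\<epsilon> n \<le> (1/2) ^ Suc n"
      by simp
  qed (simp add: less_imp_le)
  show "filterlim (\<lambda>n. ln (real (q (Suc n))) / - ln (?\<epsilon> n)) at_top sequentially"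
    using growth by (simp add: ln_div)
qed simp

end

theorem proposition6p4:
  fixes q :: "nat \<Rightarrow> nat"
  assumes "q 0 = 3"
    and "\<And>n. q (Suc n) = 2 ^ (q n - 1)"
  shows "\<exists>W\<in>W_reg q.
           (\<forall>F. folner_sequence F \<longrightarrow>
              upper_amorphic_complexity F (orbit_closure (window_sequence q W)) = \<infinity>) \<and>
           (\<forall>d. Metric_space (carrier (odometer q)) d \<longrightarrow>
              upper_box_dim (odo_topology q frontier_of W) d = 0)"
proof -
  interpret exponential_radix q
    using assms by unfold_locales
  show ?thesis
    using window_in_W_reg upper_amorphic_complexity_window
    by (intro bexI[of _ window]) (simp_all add: frontier_window upper_box_dim_singleton)
qed

end
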